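(* Let $n>1$ be an integer. Then there exist a set $F\subset\mathbb{R}$, an $n$-monotone function $f:F\to\mathbb{R}$ and a point $x_0\in\operatorname{conv}(F)\setminus F$ such that $f$ cannot be extended to an $n$-monotone function on $F\cup\{x_0\}$; that is, there is no $n$-monotone $g:F\cup\{x_0\}\to\mathbb{R}$ with $g|_F=f$.
   Context: $\operatorname{conv}(F)$ is the convex hull of $F$. Matrices are ordered by the Loewner order: $A\le B$ iff $B-A$ is positive semidefinite. For $G\subset\mathbb{R}$, a function $f:G\to\mathbb{R}$ is $n$-monotone if for all $n\times n$ (complex) Hermitian matrices $A\le B$ whose spectra are both contained in $G$ one has $f(A)\le f(B)$, where $f(A)$ is obtained by applying $f$ to the eigenvalues of $A$ in a spectral decomposition. *)

theory Defs
  imports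
    "HOL-Analysis.Convex"
    "Jordan_Normal_Form.Schur_Decomposition"
    "Jordan_Normal_Form.Spectral_Radius"
begin

definition hermitian_mat :: "complex mat \<Rightarrow> bool" where
  "hermitian_mat A \<longleftrightarrow> square_mat A \<and> mat_adjoint A = A"

definition unitary_mat :: "complex mat \<Rightarrow> bool" where
  "unitary_mat U \<longleftrightarrow> square_mat U
     \<and> U * mat_adjoint U = 1\<^sub>m (dim_row U) \<and> mat_adjoint U * U = 1\<^sub>m (dim_row U)"

definition psd_mat :: "complex mat \<Rightarrow> bool" where
  "psd_mat A \<longleftrightarrow> hermitian_mat A \<and>
     (\<forall>v \<in> carrier_vec (dim_row A). 0 \<le> Re ((A *\<^sub>v v) \<bullet>c v))"

definition loewner_le :: "complex mat \<Rightarrow> complex mat \<Rightarrow> bool" where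
  "loewner_le A B \<longleftrightarrow> psd_mat (B - A)"

definition spectral_decomp :: "complex mat \<Rightarrow> complex mat \<Rightarrow> (nat \<Rightarrow> real) \<Rightarrow> bool" where
  "spectral_decomp A U d \<longleftrightarrow> U \<in> carrier_mat (dim_row A) (dim_row A) \<and> unitary_mat U
     \<and> A = U * mat_diag (dim_row A) (\<lambda>i. complex_of_real (d i)) * mat_adjoint U"

text \<open>For Hermitian \<open>A\<close> the matrix described here exists by the spectral theorem; it does not
  depend on the chosen decomposition, see \<open>mat_fun_eq\<close> below.\<close>

definition mat_fun :: "(real \<Rightarrow> real) \<Rightarrow> complex mat \<Rightarrow> complex mat" where
  "mat_fun f A = (THE B. \<exists>U d. spectral_decomp A U d
     \<and> B = U * mat_diag (dim_row A) (\<lambda>i. complex_of_real (f (d i))) * mat_adjoint U)"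

text \<open>A function on \<open>G\<close> is represented by a total function; only its values on \<open>G\<close> matter, since
  \<open>mat_fun f A\<close> only involves the values of \<open>f\<close> on the spectrum of \<open>A\<close>.\<close>

definition n_monotone :: "nat \<Rightarrow> real set \<Rightarrow> (real \<Rightarrow> real) \<Rightarrow> bool" where
  "n_monotone n G f \<longleftrightarrow> (\<forall>A \<in> carrier_mat n n. \<forall>B \<in> carrier_mat n n.
     hermitian_mat A \<longrightarrow> hermitian_mat B \<longrightarrow>
     spectrum A \<subseteq> complex_of_real ` G \<longrightarrow> spectrum B \<subseteq> complex_of_real ` G \<longrightarrow>
     loewner_le A B \<longrightarrow> loewner_le (mat_fun f A) (mat_fun f B))"

lemma mat_adjoint_carrier:
  "U \<in> carrier_mat n m \<Longrightarrow> mat_adjoint U \<in> carrier_mat m n"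
  unfolding mat_adjoint_def by (auto simp: mat_of_rows_def)

lemma mat_fun_eq:
  assumes "spectral_decomp A U d"
  shows "mat_fun f A
    = U * mat_diag (dim_row A) (\<lambda>i. complex_of_real (f (d i))) * mat_adjoint U"
proof -
  define n where "n = dim_row A"
  define D where "D h d = mat_diag n (\<lambda>i. complex_of_real (h (d i)))"
    for h :: "real \<Rightarrow> real" and d :: "nat \<Rightarrow> real"
  have D[simp]: "D h d \<in> carrier_mat n n" for h d by (simp add: D_def)
  have unique: "V * D f e * mat_adjoint V = U * D f d * mat_adjoint U"
    if V: "spectral_decomp A V e" for V e
  proof -
    have c[simp]: "U \<in> carrier_mat n n" "V \<in> carrier_mat n n"
      using assms V by (auto simp: spectral_decomp_def n_def)
    have c'[simp]: "mat_adjoint U \<in> carrier_mat n n" "mat_adjoint V \<in> carrier_mat n n"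
      by (simp_all add: mat_adjoint_carrier)
    have U1: "U * mat_adjoint U = 1\<^sub>m n" "mat_adjoint U * U = 1\<^sub>m n"
      and V1: "V * mat_adjoint V = 1\<^sub>m n" "mat_adjoint V * V = 1\<^sub>m n"
      using assms V c by (auto simp: spectral_decomp_def unitary_mat_def)
    have AU: "A = U * D id d * mat_adjoint U" and AV: "A = V * D id e * mat_adjoint V"
      using assms V by (auto simp: spectral_decomp_def D_def n_def)
    define W where "W = mat_adjoint V * U"
    have W[simp]: "W \<in> carrier_mat n n" by (simp add: W_def mult_carrier_mat[of _ n n])
    note assoc = assoc_mult_mat[of _ n n _ n _ n] mult_carrier_mat[of _ n n _ n]
    have cancel: "mat_adjoint V * (V * X) = X" "V * (mat_adjoint V * X) = X"
      if "X \<in> carrier_mat n n" for X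
      using that V1 by (simp_all flip: assoc_mult_mat[of _ n n _ n _ n])
    have "mat_adjoint V * A * U = W * D id d"
      by (simp add: AU W_def assoc U1 right_mult_one_mat[of _ n n])
    moreover have "mat_adjoint V * A * U = D id e * W"
      by (simp add: AV W_def assoc cancel)
    ultimately have eq: "W * D id d = D id e * W" by simp
    have ij: "W $$ (i,j) * complex_of_real (d j) = complex_of_real (e i) * W $$ (i,j)"
      if "i < n" "j < n" for i j
      using arg_cong[OF eq, of "\<lambda>M. M $$ (i,j)"] that
      by (simp add: D_def mat_diag_mult_left[OF W] mat_diag_mult_right[OF W])
    have eqf: "W * D f d = D f e * W"
    proof (rule eq_matI)
      fix i j assume "i < dim_row (D f e * W)" "j < dim_col (D f e * W)"
      then have l: "i < n" "j < n" using W D[of f e] by auto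
      have "W $$ (i,j) = 0 \<or> d j = e i" using ij[OF l] by (auto simp: mult.commute)
      then show "(W * D f d) $$ (i,j) = (D f e * W) $$ (i,j)" using l
        by (auto simp add: D_def mat_diag_mult_left[OF W] mat_diag_mult_right[OF W])
    qed (simp_all add: carrier_matD[OF W] carrier_matD[OF D])
    have "V * (W * D f d) * mat_adjoint U = U * D f d * mat_adjoint U"
      by (simp add: W_def assoc cancel)
    moreover have "V * (D f e * W) * mat_adjoint U = V * D f e * mat_adjoint V"
      by (simp add: W_def assoc U1 right_mult_one_mat[of _ n n])
    ultimately show ?thesis using eqf by simp
  qed
  show ?thesis unfolding mat_fun_def
  proof (rule the_equality)
    show "\<exists>U' d'. spectral_decomp A U' d' \<and>
      U * mat_diag (dim_row A) (\<lambda>i. complex_of_real (f (d i))) * mat_adjoint U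
      = U' * mat_diag (dim_row A) (\<lambda>i. complex_of_real (f (d' i))) * mat_adjoint U'"
      using assms by blast
  qed (use unique in \<open>auto simp: D_def n_def\<close>)
qed

end

theory Submission
  imports Defs "HOL-Analysis.Function_Topology"
begin

text \<open>
  For a set \<open>S\<close> of \<open>2n\<close> real points write \<open>[S] F = (\<Sum>s\<in>S. F s / (\<Prod>t\<in>S - {s}. s - t))\<close> for the
  divided difference of order \<open>2n - 1\<close>. It kills polynomials of degree at most \<open>2n - 2\<close>. Both
  directions of the argument compare \<open>n\<close>-monotonicity with the positivity of such differences.

  Necessary condition (\<open>loewner_necessary\<close>). If \<open>g\<close> is \<open>n\<close>-monotone on a set that contains \<open>S\<close>, then
  \<open>[S] (g r\<^sup>2) \<ge> 0\<close> for every real polynomial \<open>r\<close> of degree below \<open>n\<close>. Indeed, list \<open>S\<close> in increasing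
  order as \<open>a\<^sub>0 < b\<^sub>0 < a\<^sub>1 < b\<^sub>1 < \<dots>\<close>. As \<open>[S]\<close> kills products of two polynomials of degree below
  \<open>n\<close>, Lagrange interpolation at the \<open>a\<^sub>j\<close> and at the \<open>b\<^sub>j\<close> defines the same inner product on
  these polynomials. Multiplication by \<open>x\<close> at the nodes \<open>a\<^sub>j\<close>, respectively \<open>b\<^sub>j\<close>, gives Hermitian
  matrices \<open>A \<le> B\<close>, and \<open>[S] (g r\<^sup>2)\<close> is the value of the quadratic form of \<open>g(B) - g(A)\<close> at \<open>r\<close>.

  Sufficient condition (\<open>n_monotone_criterion\<close>). Let \<open>A \<le> B\<close> have their spectra in \<open>S\<close>, and let \<open>\<lambda>\<close>
  be the difference of the spectral measures of \<open>B\<close> and \<open>A\<close> at a vector. Since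
  \<open>(c - A)\<^sup>-\<^sup>1 \<le> (c - B)\<^sup>-\<^sup>1\<close> for every \<open>c\<close> above both spectra, the polynomial
  \<open>q(x) = (\<Sum>s\<in>S. \<lambda>\<^sub>s (\<Prod>t\<in>S - {s}. x - t))\<close> of degree at most \<open>2n - 2\<close> is nonnegative to the right of \<open>S\<close>.
  So \<open>f(A) \<le> f(B)\<close> follows if \<open>\<Sum>s\<in>S. \<lambda>\<^sub>s f(s) \<ge> 0\<close> for all \<open>\<lambda>\<close> of this kind.

  The example. Let \<open>F = {1, \<dots>, 2n + 2}\<close>, choose \<open>n - 1\<close> points \<open>c\<close> to the right of \<open>F\<close> and put
  \<open>P(x) = \<Prod>\<^sub>c (x - c)\<close>. Take \<open>f = K (\<Sum>\<^sub>c 1 / (c - x)) + H / P\<^sup>2\<close> with \<open>K\<close> large. The first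
  summand contributes to \<open>\<Sum>s\<in>S. \<lambda>\<^sub>s f(s)\<close> a nonnegative multiple of \<open>K\<close>. This multiple vanishes only if
  \<open>q\<close> vanishes at all \<open>c\<close>; these zeros are then double, the degree forces \<open>q = k P\<^sup>2\<close>, and the second
  summand contributes \<open>k [S] H\<close>. By compactness, \<open>f\<close> is \<open>n\<close>-monotone for large \<open>K\<close> as soon as
  \<open>[S] H > 0\<close> for all \<open>S \<subseteq> F\<close> with \<open>2n\<close> elements. Conversely, \<open>P\<^sup>2 (\<Sum>\<^sub>c 1 / (c - x))\<close> is a polynomial of
  degree at most \<open>2n - 2\<close>, so by the necessary condition with \<open>r = P\<close> an extension of \<open>f\<close> to \<open>x\<^sub>0\<close> yields an
  extension of \<open>H\<close> to \<open>F \<union> {x\<^sub>0}\<close> with nonnegative divided differences of order \<open>2n - 1\<close>.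

  This reduces the matter to convexity of higher order on finite sets. Let \<open>N\<close> be the monic polynomial
  with the simple zeros \<open>3, \<dots>, 2n\<close>, and let \<open>H\<^sub>0\<close> be \<open>0\<close> on \<open>1, \<dots>, 2n\<close> and \<open>N\<close> on \<open>2n + 1\<close> and
  \<open>2n + 2\<close>. Its divided differences are nonnegative (\<open>divdiff_kinked_nonneg\<close>). But \<open>H\<^sub>0\<close> agrees
  with the zero polynomial on \<open>1, \<dots>, 2n\<close> and with \<open>N\<close> on \<open>3, \<dots>, 2n + 2\<close>. At a point \<open>x\<^sub>0\<close> between
  \<open>2n - 1\<close> and \<open>2n\<close> the first agreement bounds the value of an extension from below by \<open>0\<close>, and the
  second bounds it from above by \<open>N(x\<^sub>0) < 0\<close>. The contradiction survives the perturbation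
  \<open>H = H\<^sub>0 + \<epsilon> x\<^sup>2\<^sup>n\<^sup>-\<^sup>1\<close>, which makes all divided differences at least \<open>\<epsilon>\<close>.
\<close>

section \<open>Adjoints and quadratic forms\<close>

lemma mat_adjoint_index:
  assumes "i < dim_col A" "j < dim_row A"
  shows "mat_adjoint A $$ (i, j) = conjugate (A $$ (j, i))"
  using assms unfolding mat_adjoint_def by (simp add: mat_of_rows_index)

lemma mat_adjoint_dim [simp]:
  "dim_row (mat_adjoint A) = dim_col A" "dim_col (mat_adjoint A) = dim_row A"
  unfolding mat_adjoint_def by simp_all

lemma mat_adjoint_adjoint [simp]: "mat_adjoint (mat_adjoint A) = (A :: complex mat)"
  by (rule eq_matI) (simp_all add: mat_adjoint_index)

lemma mat_adjoint_mult:
  fixes A B :: "complex mat"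
  assumes "A \<in> carrier_mat n m" "B \<in> carrier_mat m k"
  shows "mat_adjoint (A * B) = mat_adjoint B * mat_adjoint A"
proof (rule eq_matI)
  fix i j assume "i < dim_row (mat_adjoint B * mat_adjoint A)" "j < dim_col (mat_adjoint B * mat_adjoint A)"
  then have ij: "i < k" "j < n" using assms by auto
  then show "mat_adjoint (A * B) $$ (i, j) = (mat_adjoint B * mat_adjoint A) $$ (i, j)"
    using assms by (simp add: mat_adjoint_index scalar_prod_def mult.commute)
qed (use assms in auto)

lemma mat_adjoint_real_diag:
  "mat_adjoint (mat_diag n (\<lambda>i. complex_of_real (d i))) = mat_diag n (\<lambda>i. complex_of_real (d i))"
  by (rule eq_matI) (auto simp: mat_adjoint_index mat_diag_def)

lemma cscalar_mult_mat_vec: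
  fixes A :: "complex mat"
  assumes "A \<in> carrier_mat n m" "v \<in> carrier_vec m" "w \<in> carrier_vec n"
  shows "(A *\<^sub>v v) \<bullet>c w = v \<bullet>c (mat_adjoint A *\<^sub>v w)"
proof -
  have "(A *\<^sub>v v) \<bullet>c w = (\<Sum>i<n. \<Sum>j<m. A $$ (i,j) * v $ j * cnj (w $ i))"
    using assms by (auto simp: scalar_prod_def sum_distrib_right lessThan_atLeast0 intro!: sum.cong)
  also have "\<dots> = (\<Sum>j<m. \<Sum>i<n. A $$ (i,j) * v $ j * cnj (w $ i))" by (rule sum.swap)
  also have "\<dots> = v \<bullet>c (mat_adjoint A *\<^sub>v w)"
    using assms by (auto simp: scalar_prod_def sum_distrib_left lessThan_atLeast0 mat_adjoint_index
        mult_ac intro!: sum.cong)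
  finally show ?thesis .
qed

lemma hermitian_index:
  assumes "hermitian_mat C" "C \<in> carrier_mat n n" "i < n" "j < n"
  shows "cnj (C $$ (j, i)) = C $$ (i, j)"
  using assms mat_adjoint_index[of i C j] unfolding hermitian_mat_def
  by (metis carrier_matD conjugate_complex_def)

lemma hermitian_conjugated_diag:
  assumes "U \<in> carrier_mat n n"
  shows "hermitian_mat (U * mat_diag n (\<lambda>i. complex_of_real (d i)) * mat_adjoint U)"
proof -
  have U': "mat_adjoint U \<in> carrier_mat n n" using assms by (rule mat_adjoint_carrier)
  have D: "mat_diag n (\<lambda>i. complex_of_real (d i)) \<in> carrier_mat n n" by simp
  have "mat_adjoint (U * mat_diag n (\<lambda>i. complex_of_real (d i)) * mat_adjoint U)
    = U * (mat_diag n (\<lambda>i. complex_of_real (d i)) * mat_adjoint U)"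
    by (simp add: mat_adjoint_mult[OF mult_carrier_mat[OF assms D] U'] mat_adjoint_mult[OF assms D]
        mat_adjoint_real_diag)
  also have "\<dots> = U * mat_diag n (\<lambda>i. complex_of_real (d i)) * mat_adjoint U"
    by (rule assoc_mult_mat[symmetric, OF assms D U'])
  finally show ?thesis using assms by (simp add: hermitian_mat_def)
qed

lemma hermitian_minus:
  assumes "hermitian_mat A" "hermitian_mat B" "A \<in> carrier_mat n n" "B \<in> carrier_mat n n"
  shows "hermitian_mat (A - B)"
proof -
  have "mat_adjoint (A - B) $$ (i, j) = (A - B) $$ (i, j)" if "i < n" "j < n" for i j
    using assms(3,4) that by (simp add: mat_adjoint_index hermitian_index[OF assms(1,3)] hermitian_index[OF assms(2,4)])
  then show ?thesis unfolding hermitian_mat_def using assms(3,4) by (auto intro!: eq_matI)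
qed

lemma loewner_le_form:
  assumes A: "A \<in> carrier_mat n n" "hermitian_mat A" and B: "B \<in> carrier_mat n n" "hermitian_mat B"
  shows "loewner_le A B \<longleftrightarrow>
    (\<forall>v\<in>carrier_vec n. Re ((A *\<^sub>v v) \<bullet>c v) \<le> Re ((B *\<^sub>v v) \<bullet>c v))"
proof -
  have "Re (((B - A) *\<^sub>v v) \<bullet>c v) = Re ((B *\<^sub>v v) \<bullet>c v) - Re ((A *\<^sub>v v) \<bullet>c v)"
    if v: "v \<in> carrier_vec n" for v
  proof -
    have "((B - A) *\<^sub>v v) \<bullet>c v = (B *\<^sub>v v - A *\<^sub>v v) \<bullet>c v"
      using A B v by (simp add: minus_mult_distrib_mat_vec)
    also have "\<dots> = (B *\<^sub>v v) \<bullet>c v - (A *\<^sub>v v) \<bullet>c v"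
      by (rule minus_scalar_prod_distrib[of _ n]) (use A B v in auto)
    finally show ?thesis by simp
  qed
  then show ?thesis using A B hermitian_minus[OF B(2) A(2) B(1) A(1)]
    by (auto simp: loewner_le_def psd_mat_def)
qed

text \<open>
  All quadratic forms below are computed in the eigenbasis given by the columns of \<open>U\<close>; the vector
  \<open>mat_adjoint U *\<^sub>v v\<close> lists the coordinates of \<open>v\<close> there.
\<close>

lemma conjugated_diag_form:
  assumes U: "U \<in> carrier_mat n n" and v: "v \<in> carrier_vec n" and w: "w \<in> carrier_vec n"
  shows "((U * mat_diag n g * mat_adjoint U) *\<^sub>v v) \<bullet>c w
    = (\<Sum>i<n. g i * (mat_adjoint U *\<^sub>v v) $ i * cnj ((mat_adjoint U *\<^sub>v w) $ i))"
proof -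
  have U': "mat_adjoint U \<in> carrier_mat n n" using U by (rule mat_adjoint_carrier)
  have D: "mat_diag n g \<in> carrier_mat n n" by simp
  define x where "x = mat_adjoint U *\<^sub>v v"
  have x: "x \<in> carrier_vec n" using U' v by (simp add: x_def)
  have "(U * mat_diag n g * mat_adjoint U) *\<^sub>v v = U *\<^sub>v (mat_diag n g *\<^sub>v x)"
    using U D U' v by (simp add: x_def assoc_mult_mat_vec[of _ n n _ n] mult_carrier_mat[of _ n n _ n])
  also have "\<dots> \<bullet>c w = (mat_diag n g *\<^sub>v x) \<bullet>c (mat_adjoint U *\<^sub>v w)"
    by (rule cscalar_mult_mat_vec[OF U _ w]) (use x D in \<open>simp add: mult_mat_vec_carrier[of _ n n]\<close>)
  also have "(mat_diag n g *\<^sub>v x) = vec n (\<lambda>i. g i * x $ i)"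
    using x by (auto simp: mat_diag_def scalar_prod_def if_distrib[of "\<lambda>z. z * _"] sum.delta' intro!: eq_vecI
        cong: if_cong)
  finally show ?thesis
    using U U' w x
    by (auto simp: scalar_prod_def x_def[symmetric] lessThan_atLeast0 intro!: sum.cong)
qed

text \<open>
  These are the masses of the spectral measure at \<open>v\<close>, listed along the eigenbasis: the measure of a
  point is the sum over all indices whose eigenvalue is that point.
\<close>

definition spec_wt :: "complex mat \<Rightarrow> complex vec \<Rightarrow> nat \<Rightarrow> real" where
  "spec_wt U v i = (cmod ((mat_adjoint U *\<^sub>v v) $ i))\<^sup>2"

lemma conjugated_real_diag_form:
  assumes U: "U \<in> carrier_mat n n" and v: "v \<in> carrier_vec n"
  shows "Re (((U * mat_diag n (\<lambda>i. complex_of_real (g i)) * mat_adjoint U) *\<^sub>v v) \<bullet>c v)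
    = (\<Sum>i<n. g i * spec_wt U v i)"
  unfolding conjugated_diag_form[OF U v v] spec_wt_def Re_sum
  by (rule sum.cong[OF refl]) (simp add: mult.assoc flip: complex_norm_square)

lemma parseval:
  assumes "U \<in> carrier_mat n n" "U * mat_adjoint U = 1\<^sub>m n" "v \<in> carrier_vec n" "w \<in> carrier_vec n"
  shows "v \<bullet>c w = (\<Sum>i<n. (mat_adjoint U *\<^sub>v v) $ i * cnj ((mat_adjoint U *\<^sub>v w) $ i))"
proof -
  have "U * mat_diag n (\<lambda>i. 1) * mat_adjoint U = 1\<^sub>m n" using assms(1,2) by simp
  then show ?thesis using conjugated_diag_form[OF assms(1,3,4), of "\<lambda>i. 1"] assms(3) by simp
qed

lemma spec_wt_sum:
  assumes "U \<in> carrier_mat n n" "U * mat_adjoint U = 1\<^sub>m n" "v \<in> carrier_vec n"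
  shows "(\<Sum>i<n. spec_wt U v i) = Re (v \<bullet>c v)"
  unfolding parseval[OF assms assms(3)] Re_sum spec_wt_def
  by (rule sum.cong[OF refl]) (simp flip: complex_norm_square)

lemma spectrum_conjugated_diag:
  assumes U: "U \<in> carrier_mat n n" "U * mat_adjoint U = 1\<^sub>m n" "mat_adjoint U * U = 1\<^sub>m n"
  shows "spectrum (U * mat_diag n g * mat_adjoint U) = g ` {..<n}"
proof -
  have U': "mat_adjoint U \<in> carrier_mat n n" using U by (simp add: mat_adjoint_carrier)
  let ?A = "U * mat_diag n g * mat_adjoint U"
  have A: "?A \<in> carrier_mat n n" using U U' by (metis mat_diag_dim mult_carrier_mat)
  have "similar_mat_wit ?A (mat_diag n g) U (mat_adjoint U)"
    by (rule similar_mat_witI[of _ _ n]) (use U U' A in auto)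
  then have "char_poly ?A = char_poly (mat_diag n g)"
    by (intro char_poly_similar) (auto simp: similar_mat_def)
  also have "\<dots> = (\<Prod>a\<leftarrow>diag_mat (mat_diag n g). [:- a, 1:])"
    by (rule char_poly_upper_triangular[of _ n]) (auto simp: mat_diag_def upper_triangular_def)
  also have "diag_mat (mat_diag n g) = map g [0..<n]"
    by (auto simp: diag_mat_def mat_diag_def)
  finally have "char_poly ?A = (\<Prod>a\<leftarrow>map g [0..<n]. [:- a, 1:])" .
  then show ?thesis unfolding spectrum_root_char_poly[OF A]
    by (auto simp: poly_prod_list prod_list_zero_iff)
qed

lemma spectral_decompD:
  assumes "spectral_decomp A U d" "A \<in> carrier_mat n n"
  shows "U \<in> carrier_mat n n" "mat_adjoint U \<in> carrier_mat n n"
    "U * mat_adjoint U = 1\<^sub>m n" "mat_adjoint U * U = 1\<^sub>m n"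
    "A = U * mat_diag n (\<lambda>i. complex_of_real (d i)) * mat_adjoint U"
    "mat_fun f A = U * mat_diag n (\<lambda>i. complex_of_real (f (d i))) * mat_adjoint U"
    "mat_fun f A \<in> carrier_mat n n"
proof -
  show U: "U \<in> carrier_mat n n" using assms by (auto simp: spectral_decomp_def)
  then show U': "mat_adjoint U \<in> carrier_mat n n" by (rule mat_adjoint_carrier)
  show "U * mat_adjoint U = 1\<^sub>m n" "mat_adjoint U * U = 1\<^sub>m n"
    "A = U * mat_diag n (\<lambda>i. complex_of_real (d i)) * mat_adjoint U"
    using assms U by (auto simp: spectral_decomp_def unitary_mat_def)
  show "mat_fun f A = U * mat_diag n (\<lambda>i. complex_of_real (f (d i))) * mat_adjoint U"
    using mat_fun_eq[OF assms(1), of f] assms by auto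
  then show "mat_fun f A \<in> carrier_mat n n"
    using U U' by (metis mat_diag_dim mult_carrier_mat)
qed

lemma mat_fun_id: "spectral_decomp A U d \<Longrightarrow> A \<in> carrier_mat n n \<Longrightarrow> mat_fun (\<lambda>x. x) A = A"
  using spectral_decompD(5)[of A U d n] spectral_decompD(6)[of A U d n "\<lambda>x. x"] by simp

lemma mat_fun_form:
  assumes "spectral_decomp A U d" "A \<in> carrier_mat n n" "v \<in> carrier_vec n"
  shows "Re ((mat_fun f A *\<^sub>v v) \<bullet>c v) = (\<Sum>i<n. f (d i) * spec_wt U v i)"
  unfolding spectral_decompD(6)[OF assms(1,2)]
  by (rule conjugated_real_diag_form[OF spectral_decompD(1)[OF assms(1,2)] assms(3)])

lemma spectral_decomp_spectrum:
  assumes "spectral_decomp A U d" "A \<in> carrier_mat n n"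
  shows "spectrum A = (\<lambda>i. complex_of_real (d i)) ` {..<n}"
  using spectrum_conjugated_diag[of U n "\<lambda>i. complex_of_real (d i)"] spectral_decompD(1,3,4,5)[OF assms]
  by simp

section \<open>The spectral theorem for Hermitian matrices\<close>

text \<open>
  Gram-Schmidt yields a basis that is orthogonal but not normalised, hence the factors \<open>1 / s j\<close>.
\<close>

lemma unitary_with_first_column:
  fixes v :: "complex vec"
  assumes v: "v \<in> carrier_vec n" "v \<noteq> 0\<^sub>v n"
  shows "\<exists>W a. W \<in> carrier_mat n n \<and> W * mat_adjoint W = 1\<^sub>m n \<and> mat_adjoint W * W = 1\<^sub>m n
    \<and> col W 0 = a \<cdot>\<^sub>v v"
proof -
  interpret cof_vec_space n "TYPE(complex)" .
  have n: "n > 0" using v by (cases n) auto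
  define b where "b = basis_completion v"
  from basis_completion[OF v, folded b_def]
  have dist: "distinct b" and indep: "\<not> lin_dep (set b)" and b: "set b \<subseteq> carrier_vec n"
    and hdb: "hd b = v" and len_b: "length b = n" by auto
  then obtain vs where bv: "b = v # vs" using n by (cases b) auto
  define ws where "ws = gram_schmidt n b"
  from gram_schmidt_result[OF b dist indep refl, folded ws_def]
  have ws: "set ws \<subseteq> carrier_vec n" "corthogonal ws" "length ws = n" by (auto simp: len_b)
  have hd: "ws ! 0 = v"
    using gram_schmidt_hd[OF v(1), of vs, folded bv] ws(3) n
    by (cases ws) (auto simp: ws_def)
  have wsc: "ws ! i \<in> carrier_vec n" if "i < n" for i using ws that by auto
  define s where "s i = sqrt (Re (ws ! i \<bullet>c ws ! i))" for i
  have s: "s i > 0" "ws ! i \<bullet>c ws ! i = complex_of_real ((s i)\<^sup>2)" if "i < n" for i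
  proof -
    have "ws ! i \<bullet>c ws ! i \<noteq> 0" using corthogonalD[OF ws(2), of i i] ws(3) that by auto
    moreover have "ws ! i \<bullet>c ws ! i \<ge> 0" using conjugate_square_ge_0_vec[of "ws ! i"] by simp
    ultimately have *: "Re (ws ! i \<bullet>c ws ! i) > 0" "Im (ws ! i \<bullet>c ws ! i) = 0"
      by (auto simp: less_eq_complex_def complex_eq_iff)
    then show "s i > 0" "ws ! i \<bullet>c ws ! i = complex_of_real ((s i)\<^sup>2)"
      by (auto simp: s_def complex_eq_iff)
  qed
  define W where "W = mat n n (\<lambda>(i, j). complex_of_real (1 / s j) * (ws ! j) $ i)"
  have W: "W \<in> carrier_mat n n" by (simp add: W_def)
  have "mat_adjoint W * W = 1\<^sub>m n"
  proof (rule eq_matI)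
    fix i j assume "i < dim_row (1\<^sub>m n :: complex mat)" "j < dim_col (1\<^sub>m n :: complex mat)"
    then have ij: "i < n" "j < n" by auto
    have "(mat_adjoint W * W) $$ (i, j) = (\<Sum>k<n. cnj (W $$ (k, i)) * W $$ (k, j))"
      using ij W by (auto simp: scalar_prod_def mat_adjoint_index lessThan_atLeast0 intro!: sum.cong)
    also have "\<dots> = (\<Sum>k<n. complex_of_real (1 / s i * (1 / s j)) * ((ws ! j) $ k * cnj ((ws ! i) $ k)))"
      using ij by (auto simp: W_def mult_ac intro!: sum.cong)
    also have "\<dots> = complex_of_real (1 / s i * (1 / s j)) * (ws ! j \<bullet>c ws ! i)"
      using wsc[OF ij(1)] wsc[OF ij(2)]
      by (auto simp: scalar_prod_def sum_distrib_left lessThan_atLeast0 intro!: sum.cong)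
    also have "\<dots> = (1\<^sub>m n) $$ (i, j)"
    proof (cases "i = j")
      case True
      then show ?thesis using s[OF ij(1)] ij by (simp add: power2_eq_square)
    next
      case False
      then show ?thesis using corthogonalD[OF ws(2), of j i] ij ws(3) by auto
    qed
    finally show "(mat_adjoint W * W) $$ (i, j) = (1\<^sub>m n) $$ (i, j)" .
  qed (use W in auto)
  moreover from this have "W * mat_adjoint W = 1\<^sub>m n"
    using mat_mult_left_right_inverse[OF mat_adjoint_carrier[OF W] W] by simp
  moreover have "col W 0 = complex_of_real (1 / s 0) \<cdot>\<^sub>v v"
    using n v(1) hd by (intro eq_vecI) (auto simp: W_def)
  ultimately show ?thesis using W by blast
qed

text \<open>
  Induction on the size. Conjugation with a unitary matrix whose first column is an eigenvector makes
  the first column of \<open>A\<close> a multiple of the first unit vector; since \<open>A\<close> is Hermitian, the same holds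
  for the first row, and the remaining block is a smaller Hermitian matrix.
\<close>

lemma spectral_theorem:
  assumes "A \<in> carrier_mat n n" "hermitian_mat A"
  shows "\<exists>U d. spectral_decomp A U d"
  using assms
proof (induction n arbitrary: A)
  case 0
  then have "spectral_decomp A (1\<^sub>m 0) (\<lambda>_. 0)"
    by (auto simp: spectral_decomp_def unitary_mat_def intro!: eq_matI)
  then show ?case by blast
next
  case (Suc n)
  let ?N = "Suc n"
  note A = Suc.prems(1)
  obtain e where "e \<in> spectrum A" using spectrum_non_empty[OF A] by auto
  then obtain v where v: "v \<in> carrier_vec ?N" "v \<noteq> 0\<^sub>v ?N" "A *\<^sub>v v = e \<cdot>\<^sub>v v"
    using A by (auto simp: spectrum_def eigenvalue_def eigenvector_def)
  from unitary_with_first_column[OF v(1,2)] obtain W a where W: "W \<in> carrier_mat ?N ?N"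
    "W * mat_adjoint W = 1\<^sub>m ?N" "mat_adjoint W * W = 1\<^sub>m ?N" "col W 0 = a \<cdot>\<^sub>v v" by blast
  have W': "mat_adjoint W \<in> carrier_mat ?N ?N" using W(1) by (rule mat_adjoint_carrier)
  define B where "B = mat_adjoint W * (A * W)"
  have AW: "A * W \<in> carrier_mat ?N ?N" using A W by simp
  have B: "B \<in> carrier_mat ?N ?N" using AW W' by (simp add: B_def)
  have Bh: "hermitian_mat B"
  proof -
    have "mat_adjoint B = (mat_adjoint W * A) * W"
      using Suc.prems(2) unfolding B_def
      by (simp add: mat_adjoint_mult[OF W' AW] mat_adjoint_mult[OF A W(1)] hermitian_mat_def)
    also have "\<dots> = B" unfolding B_def by (rule assoc_mult_mat[OF W' A W(1)])
    finally show ?thesis using B by (simp add: hermitian_mat_def)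
  qed
  have "col (A * W) 0 = A *\<^sub>v (a \<cdot>\<^sub>v v)"
    using col_mult2[OF A W(1), of 0] W(4) by simp
  also have "\<dots> = e \<cdot>\<^sub>v col W 0"
    unfolding mult_mat_vec[OF A v(1)] v(3) W(4) by (simp add: smult_smult_assoc mult.commute)
  finally have "col B 0 = mat_adjoint W *\<^sub>v (e \<cdot>\<^sub>v col W 0)"
    using col_mult2[OF W' AW, of 0] by (simp add: B_def)
  also have "\<dots> = e \<cdot>\<^sub>v col (mat_adjoint W * W) 0"
    using col_mult2[OF W' W(1), of 0] mult_mat_vec[OF W' col_carrier_vec[OF _ W(1), of 0], of e] by simp
  finally have "col B 0 $ i = (if i = 0 then e else 0)" if "i < ?N" for i
    using that by (simp add: W(3))
  then have B0: "B $$ (i, 0) = (if i = 0 then e else 0)" if "i < ?N" for i using that B by simp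
  have e: "complex_of_real (Re e) = e"
    using hermitian_index[OF Bh B, of 0 0] B0[of 0] by (simp add: complex_eq_iff)
  have B0': "B $$ (0, i) = (if i = 0 then e else 0)" if "i < ?N" for i
    using hermitian_index[OF Bh B, of 0 i] B0[OF that] B0[of 0] that e by (auto split: if_splits)
  define C where "C = mat n n (\<lambda>(i, j). B $$ (Suc i, Suc j))"
  have C: "C \<in> carrier_mat n n" by (simp add: C_def)
  have "hermitian_mat C"
    using hermitian_index[OF Bh B] by (auto simp: hermitian_mat_def mat_adjoint_index C_def intro!: eq_matI)
  from Suc.IH[OF C this] obtain U d where "spectral_decomp C U d" by blast
  note U = spectral_decompD[OF this C]
  \<comment> \<open>the block matrix \<open>diag(1, U)\<close>\<close>
  define V where "V = mat ?N ?N (\<lambda>(i, j). case i of 0 \<Rightarrow> if j = 0 then 1 else 0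
    | Suc i' \<Rightarrow> (case j of 0 \<Rightarrow> 0 | Suc j' \<Rightarrow> U $$ (i', j')))"
  define d' where "d' = case_nat (Re e) d"
  have V: "V \<in> carrier_mat ?N ?N" by (simp add: V_def)
  have V': "mat_adjoint V \<in> carrier_mat ?N ?N" using V by (rule mat_adjoint_carrier)
  have Vi: "V $$ (0, 0) = 1" "i < n \<Longrightarrow> V $$ (0, Suc i) = 0" "i < n \<Longrightarrow> V $$ (Suc i, 0) = 0"
    "i < n \<Longrightarrow> j < n \<Longrightarrow> V $$ (Suc i, Suc j) = U $$ (i, j)" for i j
    by (simp_all add: V_def)
  have prod: "(X * mat_diag m g * mat_adjoint X) $$ (i, j) = (\<Sum>k<m. X $$ (i, k) * g k * cnj (X $$ (j, k)))"
    if "X \<in> carrier_mat m m" "i < m" "j < m" for X :: "complex mat" and m g i j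
    unfolding mat_diag_mult_right[OF that(1)] using that
    by (simp add: scalar_prod_def mat_adjoint_index lessThan_atLeast0)
  have Vg: "V * mat_diag ?N (case_nat p g) * mat_adjoint V = mat ?N ?N (\<lambda>(i, j). case i of 0 \<Rightarrow> if j = 0 then p else 0
    | Suc i' \<Rightarrow> (case j of 0 \<Rightarrow> 0 | Suc j' \<Rightarrow> (U * mat_diag n g * mat_adjoint U) $$ (i', j')))" (is "?L = ?R") for p g
  proof (rule eq_matI)
    fix i j assume "i < dim_row ?R" "j < dim_col ?R"
    then have ij: "i < ?N" "j < ?N" by auto
    show "?L $$ (i, j) = ?R $$ (i, j)"
      unfolding prod[OF V ij] sum.lessThan_Suc_shift using ij
      by (cases i; cases j) (simp_all add: Vi prod[OF U(1)] del: index_mult_mat)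
  qed (use V V' in auto)
  have BV: "B = V * mat_diag ?N (\<lambda>i. complex_of_real (d' i)) * mat_adjoint V" (is "_ = ?R")
  proof -
    have "(\<lambda>i. complex_of_real (d' i)) = case_nat e (\<lambda>i. complex_of_real (d i))"
      by (auto simp: d'_def e fun_eq_iff split: nat.splits)
    then have "?R = mat ?N ?N (\<lambda>(i, j). case i of 0 \<Rightarrow> if j = 0 then e else 0
      | Suc i' \<Rightarrow> (case j of 0 \<Rightarrow> 0 | Suc j' \<Rightarrow> C $$ (i', j')))"
      unfolding U(5) by (simp only: Vg)
    also have "\<dots> = B"
      by (rule eq_matI) (use B in \<open>auto simp: B0 B0' C_def split: nat.splits\<close>)
    finally show ?thesis by simp
  qed
  have V1: "V * mat_adjoint V = 1\<^sub>m ?N"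
  proof -
    have "case_nat 1 (\<lambda>i. 1 :: complex) = (\<lambda>i. 1)" by (auto simp: fun_eq_iff split: nat.splits)
    then have "V * mat_adjoint V = V * mat_diag ?N (case_nat 1 (\<lambda>i. 1)) * mat_adjoint V"
      using V by simp
    also have "\<dots> = 1\<^sub>m ?N"
      unfolding Vg using U(1,3) by (auto split: nat.splits intro!: eq_matI)
    finally show ?thesis .
  qed
  have V2: "mat_adjoint V * V = 1\<^sub>m ?N" by (rule mat_mult_left_right_inverse[OF V V' V1])
  let ?D = "mat_diag ?N (\<lambda>i. complex_of_real (d' i))"
  have D: "?D \<in> carrier_mat ?N ?N" by simp
  define Q where "Q = W * V"
  have Q: "Q \<in> carrier_mat ?N ?N" using W V by (simp add: Q_def)
  have Q': "mat_adjoint Q = mat_adjoint V * mat_adjoint W" unfolding Q_def by (rule mat_adjoint_mult[OF W(1) V])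
  note assoc = assoc_mult_mat[of _ ?N ?N _ ?N _ ?N] mult_carrier_mat[of _ ?N ?N _ ?N]
  have cancel: "W * (mat_adjoint W * X) = X" "V * (mat_adjoint V * X) = X" "mat_adjoint W * (W * X) = X"
      "mat_adjoint V * (V * X) = X" if "X \<in> carrier_mat ?N ?N" for X
      using that W V V' W' V1 V2 by (simp_all flip: assoc_mult_mat[of _ ?N ?N _ ?N _ ?N])
  have "A = W * B * mat_adjoint W"
    using A W W' by (simp add: B_def assoc cancel)
  also have "\<dots> = Q * ?D * mat_adjoint Q"
    unfolding BV Q' unfolding Q_def using A W W' V V' by (simp add: assoc D)
  finally have "A = Q * ?D * mat_adjoint Q" .
  moreover have "Q * mat_adjoint Q = 1\<^sub>m ?N" "mat_adjoint Q * Q = 1\<^sub>m ?N"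
    unfolding Q' unfolding Q_def using W W' V V' V1 V2 by (simp_all add: assoc cancel)
  ultimately have "spectral_decomp A Q d'"
    using A Q by (auto simp: spectral_decomp_def unitary_mat_def)
  then show ?case by blast
qed

section \<open>Divided differences and interpolation\<close>

definition divdiff :: "real set \<Rightarrow> (real \<Rightarrow> real) \<Rightarrow> real" where
  "divdiff S f = (\<Sum>s\<in>S. f s / (\<Prod>t\<in>S - {s}. s - t))"

lemma divdiff_add: "divdiff S (\<lambda>s. f s + g s) = divdiff S f + divdiff S g"
  by (simp add: divdiff_def add_divide_distrib sum.distrib)

lemma divdiff_cmult: "divdiff S (\<lambda>s. a * f s) = a * divdiff S f"
  by (simp add: divdiff_def sum_distrib_left)

lemma divdiff_cong: "(\<And>s. s \<in> S \<Longrightarrow> f s = g s) \<Longrightarrow> divdiff S f = divdiff S g"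
  by (simp add: divdiff_def)

lemma divdiff_single:
  assumes "finite S" "x \<in> S"
  shows "divdiff S (\<lambda>s. if s = x then y else 0) = y / (\<Prod>t\<in>S - {x}. x - t)"
proof -
  have "divdiff S (\<lambda>s. if s = x then y else 0) = (\<Sum>s\<in>S. if s = x then y / (\<Prod>t\<in>S - {x}. x - t) else 0)"
    unfolding divdiff_def by (intro sum.cong) auto
  then show ?thesis using assms by simp
qed

text \<open>
  This is \<open>(\<Prod>s\<in>S. x - s) * (\<Sum>s\<in>S. lam s / (x - s))\<close> with the poles cleared: it encodes the masses
  \<open>lam s\<close> as values at the nodes, and the sign of \<open>\<Sum>s\<in>S. lam s / (c - s)\<close> as a sign to the right of \<open>S\<close>.
\<close>

definition node_poly :: "real set \<Rightarrow> (real \<Rightarrow> real) \<Rightarrow> real poly" where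
  "node_poly S lam = (\<Sum>s\<in>S. Polynomial.smult (lam s) (\<Prod>t\<in>S - {s}. [:- t, 1:]))"

lemma prod_linear_monic:
  assumes "finite T"
  shows "degree (\<Prod>t\<in>T. [:- t, 1 :: real:]) = card T" "coeff (\<Prod>t\<in>T. [:- t, 1 :: real:]) (card T) = 1"
proof -
  show d: "degree (\<Prod>t\<in>T. [:- t, 1 :: real:]) = card T"
    by (subst degree_prod_eq_sum_degree) auto
  have "lead_coeff (\<Prod>t\<in>T. [:- t, 1 :: real:]) = 1" by (simp add: lead_coeff_prod)
  then show "coeff (\<Prod>t\<in>T. [:- t, 1 :: real:]) (card T) = 1" by (simp only: d)
qed

lemma node_diff_nonzero: "finite S \<Longrightarrow> (\<Prod>t\<in>S - {s}. s - t) \<noteq> (0 :: real)"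
  by auto

lemma poly_node_poly_node:
  assumes "finite S" "s \<in> S"
  shows "poly (node_poly S lam) s = lam s * (\<Prod>t\<in>S - {s}. s - t)"
proof -
  have "poly (node_poly S lam) s = (\<Sum>r\<in>S. lam r * (\<Prod>t\<in>S - {r}. s - t))"
    by (simp add: node_poly_def poly_sum poly_prod)
  also have "\<dots> = (\<Sum>r\<in>S. if r = s then lam s * (\<Prod>t\<in>S - {s}. s - t) else 0)"
    using assms by (intro sum.cong) (auto simp: prod_zero_iff)
  finally show ?thesis using assms by simp
qed

lemma poly_node_poly:
  assumes "finite S" "c \<notin> S"
  shows "poly (node_poly S lam) c = (\<Prod>t\<in>S. c - t) * (\<Sum>s\<in>S. lam s / (c - s))"
proof -
  have "(\<Prod>t\<in>S - {s}. c - t) = (\<Prod>t\<in>S. c - t) / (c - s)" if "s \<in> S" for s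
    using that assms by (auto simp: prod.remove)
  then show ?thesis
    by (auto simp: node_poly_def poly_sum poly_prod sum_distrib_left intro!: sum.cong)
qed

lemma node_poly_degree:
  assumes "finite S"
  shows "degree (node_poly S lam) \<le> card S - 1"
    and "coeff (node_poly S lam) (card S - 1) = (\<Sum>s\<in>S. lam s)"
proof -
  show "degree (node_poly S lam) \<le> card S - 1"
    unfolding node_poly_def
    by (rule degree_sum_le) (use assms in \<open>auto simp: prod_linear_monic intro: le_trans[OF degree_smult_le]\<close>)
  have "coeff (\<Prod>t\<in>S - {s}. [:- t, 1 :: real:]) (card S - 1) = 1" if "s \<in> S" for s
    using prod_linear_monic(2)[of "S - {s}"] assms that by simp
  then show "coeff (node_poly S lam) (card S - 1) = (\<Sum>s\<in>S. lam s)"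
    by (auto simp: node_poly_def coeff_sum intro!: sum.cong)
qed

text \<open>
  Lagrange interpolation recovers \<open>p\<close> from its values on \<open>S\<close>; the divided difference is the leading
  coefficient of the interpolating polynomial.
\<close>

lemma divdiff_poly:
  assumes "finite S" "degree p < card S"
  shows "divdiff S (poly p) = coeff p (card S - 1)"
proof -
  let ?lam = "\<lambda>s. poly p s / (\<Prod>t\<in>S - {s}. s - t)"
  have "node_poly S ?lam = p"
  proof (rule poly_eqI_degree[of S])
    fix x assume "x \<in> S"
    then show "poly (node_poly S ?lam) x = poly p x"
      using node_diff_nonzero[OF assms(1), of x] assms(1) by (simp add: poly_node_poly_node)
  qed (use assms node_poly_degree(1)[OF assms(1), of ?lam] in auto)
  then show ?thesis using node_poly_degree(2)[OF assms(1), of ?lam] by (simp add: divdiff_def)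
qed

lemma divdiff_power:
  assumes "finite S" "card S = Suc m"
  shows "divdiff S (\<lambda>s. s ^ m) = 1"
  using divdiff_poly[of S "monom 1 m"] assms by (simp add: poly_monom[abs_def] degree_monom_eq)

section \<open>A sufficient condition for monotonicity\<close>

text \<open>
  The inequality \<open>(c - A)\<^sup>-\<^sup>1 \<le> (c - B)\<^sup>-\<^sup>1\<close> at \<open>v\<close>. With \<open>y = (c - A)\<^sup>-\<^sup>1 v\<close> the left-hand side \<open>L\<close> is both
  \<open>\<langle>(c - A) y, y\<rangle> \<ge> \<langle>(c - B) y, y\<rangle>\<close> and \<open>\<langle>v, y\<rangle>\<close>. Expanding \<open>\<langle>v, y\<rangle>\<close> in the eigenbasis of \<open>B\<close> and
  using \<open>2 |p q| \<le> |p|\<^sup>2 / t + t |q|\<^sup>2\<close> with \<open>t = c - e i\<close> gives \<open>2 L \<le> R + L\<close> for the right-hand side \<open>R\<close>.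
\<close>

lemma resolvent_monotone:
  assumes A: "A \<in> carrier_mat n n" "spectral_decomp A U d"
    and B: "B \<in> carrier_mat n n" "spectral_decomp B V e"
    and le: "\<And>v. v \<in> carrier_vec n \<Longrightarrow> Re ((A *\<^sub>v v) \<bullet>c v) \<le> Re ((B *\<^sub>v v) \<bullet>c v)"
    and c: "\<And>i. i < n \<Longrightarrow> d i < c" "\<And>i. i < n \<Longrightarrow> e i < c"
    and v: "v \<in> carrier_vec n"
  shows "(\<Sum>i<n. spec_wt U v i / (c - d i)) \<le> (\<Sum>i<n. spec_wt V v i / (c - e i))"
proof -
  note U = spectral_decompD[OF A(2,1)]
  note V = spectral_decompD[OF B(2,1)]
  let ?x = "mat_adjoint U *\<^sub>v v"
  define z where "z = vec n (\<lambda>i. ?x $ i / complex_of_real (c - d i))"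
  define y where "y = U *\<^sub>v z"
  have z: "z \<in> carrier_vec n" and y: "y \<in> carrier_vec n"
    using U(1) by (auto simp: z_def y_def)
  have Uy: "mat_adjoint U *\<^sub>v y = z"
    unfolding y_def using U(1,2,4) z by (simp flip: assoc_mult_mat_vec[of _ n n _ n])
  have wy: "spec_wt U y i = spec_wt U v i / (c - d i)\<^sup>2" if "i < n" for i
    using that by (simp add: spec_wt_def Uy) (simp add: z_def norm_divide power_divide flip: of_real_diff)
  let ?L = "\<Sum>i<n. spec_wt U v i / (c - d i)" and ?R = "\<Sum>i<n. spec_wt V v i / (c - e i)"
  have L1: "?L = (\<Sum>i<n. (c - d i) * spec_wt U y i)"
    by (rule sum.cong[OF refl]) (use c(1) in \<open>force simp: wy power2_eq_square divide_simps\<close>)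
  have L2: "(\<Sum>i<n. (c - d i) * spec_wt U y i) = c * Re (y \<bullet>c y) - Re ((A *\<^sub>v y) \<bullet>c y)"
    using mat_fun_form[OF A(2,1) y, of "\<lambda>x. x"] spec_wt_sum[OF U(1,3) y]
    by (simp add: mat_fun_id[OF A(2,1)] algebra_simps sum_subtractf flip: sum_distrib_left)
  have R2: "(\<Sum>i<n. (c - e i) * spec_wt V y i) = c * Re (y \<bullet>c y) - Re ((B *\<^sub>v y) \<bullet>c y)"
    using mat_fun_form[OF B(2,1) y, of "\<lambda>x. x"] spec_wt_sum[OF V(1,3) y]
    by (simp add: mat_fun_id[OF B(2,1)] algebra_simps sum_subtractf flip: sum_distrib_left)
  have R1: "(\<Sum>i<n. (c - e i) * spec_wt V y i) \<le> ?L"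
    using le[OF y] L1 L2 R2 by simp
  have "?L = Re (v \<bullet>c y)"
    unfolding parseval[OF U(1,3) v y] Uy Re_sum
  proof (rule sum.cong[OF refl])
    fix i assume "i \<in> {..<n}"
    then have i: "i < n" by simp
    have "?x $ i * cnj (z $ i) = ?x $ i * cnj (?x $ i) / complex_of_real (c - d i)"
      using i by (simp add: z_def)
    then show "spec_wt U v i / (c - d i) = Re (?x $ i * cnj (z $ i))"
      by (simp only: spec_wt_def Re_complex_of_real flip: complex_norm_square of_real_divide)
  qed
  also have "\<dots> = (\<Sum>i<n. Re ((mat_adjoint V *\<^sub>v v) $ i * cnj ((mat_adjoint V *\<^sub>v y) $ i)))"
    unfolding parseval[OF V(1,3) v y] Re_sum ..
  also have "2 * \<dots> \<le> (\<Sum>i<n. spec_wt V v i / (c - e i) + (c - e i) * spec_wt V y i)"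
    unfolding sum_distrib_left
  proof (rule sum_mono)
    fix i assume "i \<in> {..<n}"
    then have t: "c - e i > 0" using c(2) by simp
    define s where "s = sqrt (c - e i)"
    have s: "s > 0" "c - e i = s\<^sup>2" using t by (auto simp: s_def)
    define p q where "p = (mat_adjoint V *\<^sub>v v) $ i" and "q = (mat_adjoint V *\<^sub>v y) $ i"
    have "Re (p * cnj q) \<le> cmod p * cmod q"
      using complex_Re_le_cmod[of "p * cnj q"] by (simp add: norm_mult)
    moreover have "0 \<le> (cmod p / s - s * cmod q)\<^sup>2" by simp
    then have "2 * (cmod p * cmod q) \<le> (cmod p)\<^sup>2 / s\<^sup>2 + s\<^sup>2 * (cmod q)\<^sup>2"
      using s(1) by (simp add: power2_diff power_mult_distrib power_divide)
    ultimately show "2 * Re ((mat_adjoint V *\<^sub>v v) $ i * cnj ((mat_adjoint V *\<^sub>v y) $ i))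
        \<le> spec_wt V v i / (c - e i) + (c - e i) * spec_wt V y i"
      unfolding spec_wt_def p_def[symmetric] q_def[symmetric] s(2) by linarith
  qed
  also have "\<dots> = ?R + (\<Sum>i<n. (c - e i) * spec_wt V y i)" by (rule sum.distrib)
  finally show ?thesis using R1 by linarith
qed

text \<open>
  The property of the difference of the spectral measures of \<open>B\<close> and \<open>A\<close> that remains of \<open>A \<le> B\<close>: the
  total masses agree, and the resolvents are ordered at every point to the right of \<open>M\<close>.
\<close>

definition resolvent_positive :: "real \<Rightarrow> real set \<Rightarrow> (real \<Rightarrow> real) \<Rightarrow> bool" where
  "resolvent_positive M S lam \<longleftrightarrow> (\<Sum>s\<in>S. lam s) = 0 \<and> (\<forall>c>M. 0 \<le> (\<Sum>s\<in>S. lam s / (c - s)))"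

lemma sum_grouped:
  fixes w :: "nat \<Rightarrow> real"
  assumes "finite S" "d ` {..<n} \<subseteq> S"
  shows "(\<Sum>s\<in>S. (\<Sum>i | i < n \<and> d i = s. w i) * g s) = (\<Sum>i<n. w i * g (d i))"
proof -
  have "(\<Sum>s\<in>S. (\<Sum>i | i < n \<and> d i = s. w i) * g s) = (\<Sum>s\<in>S. \<Sum>i\<in>{i\<in>{..<n}. d i = s}. w i * g (d i))"
    by (auto simp: sum_distrib_right intro!: sum.cong)
  also have "\<dots> = (\<Sum>i<n. w i * g (d i))" by (rule sum.group) (use assms in auto)
  finally show ?thesis .
qed

text \<open>
  Two \<open>n \<times> n\<close> matrices have at most \<open>2 n\<close> eigenvalues together, so one set \<open>S\<close> with \<open>2 n\<close> elements
  carries both spectral measures; points of \<open>S\<close> that are not eigenvalues get mass \<open>0\<close>.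
\<close>

lemma n_monotone_criterion:
  assumes F: "finite F" "2 * n \<le> card F" "\<And>x. x \<in> F \<Longrightarrow> x \<le> M"
    and pos: "\<And>S lam. \<lbrakk>S \<subseteq> F; card S = 2 * n; resolvent_positive M S lam\<rbrakk> \<Longrightarrow> 0 \<le> (\<Sum>s\<in>S. lam s * f s)"
  shows "n_monotone n F f"
  unfolding n_monotone_def
proof (intro ballI impI)
  fix A B assume A: "A \<in> carrier_mat n n" "hermitian_mat A" "spectrum A \<subseteq> complex_of_real ` F"
    and B: "B \<in> carrier_mat n n" "hermitian_mat B" "spectrum B \<subseteq> complex_of_real ` F"
    and AB: "loewner_le A B"
  obtain U d where d: "spectral_decomp A U d" using spectral_theorem[OF A(1,2)] by blast
  obtain V e where e: "spectral_decomp B V e" using spectral_theorem[OF B(1,2)] by blast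
  note U = spectral_decompD[OF d A(1)] and V = spectral_decompD[OF e B(1)]
  have dF: "d ` {..<n} \<subseteq> F" and eF: "e ` {..<n} \<subseteq> F"
    using spectral_decomp_spectrum[OF d A(1)] spectral_decomp_spectrum[OF e B(1)] A(3) B(3) by auto
  have "card (d ` {..<n} \<union> e ` {..<n}) \<le> 2 * n"
    using card_Un_le[of "d ` {..<n}" "e ` {..<n}"] card_image_le[of "{..<n}" d] card_image_le[of "{..<n}" e] by auto
  then obtain S where S: "d ` {..<n} \<union> e ` {..<n} \<subseteq> S" "S \<subseteq> F" "card S = 2 * n"
    using exists_subset_between[of "d ` {..<n} \<union> e ` {..<n}" "2 * n" F] dF eF F by auto
  have fS: "finite S" using S(2) F(1) by (rule finite_subset)
  have le: "Re ((A *\<^sub>v v) \<bullet>c v) \<le> Re ((B *\<^sub>v v) \<bullet>c v)" if "v \<in> carrier_vec n" for v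
    using AB that loewner_le_form[OF A(1,2) B(1,2)] by blast
  show "loewner_le (mat_fun f A) (mat_fun f B)"
    unfolding loewner_le_form[OF U(7) hermitian_conjugated_diag[OF U(1), of "\<lambda>i. f (d i)", folded U(6)]
        V(7) hermitian_conjugated_diag[OF V(1), of "\<lambda>i. f (e i)", folded V(6)]]
  proof
    fix v :: "complex vec" assume v: "v \<in> carrier_vec n"
    \<comment> \<open>the difference of the spectral measures of \<open>B\<close> and \<open>A\<close> at \<open>v\<close>\<close>
    define lam where "lam s = (\<Sum>i | i < n \<and> e i = s. spec_wt V v i) - (\<Sum>i | i < n \<and> d i = s. spec_wt U v i)" for s
    have lam: "(\<Sum>s\<in>S. lam s * g s) = (\<Sum>i<n. spec_wt V v i * g (e i)) - (\<Sum>i<n. spec_wt U v i * g (d i))" for g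
      using S(1) fS by (simp add: lam_def left_diff_distrib sum_subtractf sum_grouped)
    have "resolvent_positive M S lam"
      unfolding resolvent_positive_def
    proof (intro conjI allI impI)
      show "(\<Sum>s\<in>S. lam s) = 0"
        using lam[of "\<lambda>_. 1"] spec_wt_sum[OF U(1,3) v] spec_wt_sum[OF V(1,3) v] by simp
      fix c assume "c > M"
      then have "x < c" if "x \<in> F" for x using F(3)[OF that] by simp
      then have "(\<Sum>i<n. spec_wt U v i / (c - d i)) \<le> (\<Sum>i<n. spec_wt V v i / (c - e i))"
        using dF eF by (intro resolvent_monotone[OF A(1) d B(1) e le _ _ v]) auto
      then show "0 \<le> (\<Sum>s\<in>S. lam s / (c - s))" using lam[of "\<lambda>s. 1 / (c - s)"] by simp
    qed
    then have "0 \<le> (\<Sum>s\<in>S. lam s * f s)" using pos S by blast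
    then show "Re ((mat_fun f A *\<^sub>v v) \<bullet>c v) \<le> Re ((mat_fun f B *\<^sub>v v) \<bullet>c v)"
      unfolding mat_fun_form[OF d A(1) v] mat_fun_form[OF e B(1) v] lam by (simp add: mult.commute)
  qed
qed

section \<open>A necessary condition for monotonicity\<close>

lemma sign_node_diff_prod:
  fixes x :: "nat \<Rightarrow> real"
  assumes mono: "\<And>i j. i < j \<Longrightarrow> j < m \<Longrightarrow> x i < x j" and k: "k < m"
  shows "0 < (-1) ^ (m - Suc k) * (\<Prod>l\<in>{..<m} - {k}. x k - x l)"
proof -
  have split: "{..<m} - {k} = {..<k} \<union> {k<..<m}" using k by auto
  have "(\<Prod>l\<in>{..<m} - {k}. x k - x l) = (\<Prod>l<k. x k - x l) * (\<Prod>l\<in>{k<..<m}. x k - x l)"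
    unfolding split by (rule prod.union_disjoint) auto
  also have "(\<Prod>l\<in>{k<..<m}. x k - x l) = (\<Prod>l\<in>{k<..<m}. (-1) * (x l - x k))"
    by (intro prod.cong) auto
  also have "\<dots> = (-1) ^ (m - Suc k) * (\<Prod>l\<in>{k<..<m}. x l - x k)"
    by (simp only: prod.distrib) simp
  finally have "(-1) ^ (m - Suc k) * (\<Prod>l\<in>{..<m} - {k}. x k - x l)
    = (\<Prod>l<k. x k - x l) * (\<Prod>l\<in>{k<..<m}. x l - x k)"
    by (simp flip: power_mult_distrib)
  moreover have "0 < (\<Prod>l<k. x k - x l)" "0 < (\<Prod>l\<in>{k<..<m}. x l - x k)"
    using mono k by (auto intro!: prod_pos)
  ultimately show ?thesis by simp
qed

text \<open>
  The sign of the node product at a point of \<open>S\<close> is determined by the parity of the number of larger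
  points. Since \<open>card S\<close> is even, the smallest point has a negative sign, and the signs alternate.
\<close>

lemma alternating_enumeration:
  fixes S :: "real set"
  assumes S: "finite S" "card S = 2 * n"
  obtains a b :: "nat \<Rightarrow> real"
  where "inj_on a {..<n}" "a ` {..<n} \<union> b ` {..<n} = S"
    and "\<And>j. j < n \<Longrightarrow> (\<Prod>t\<in>S - {a j}. a j - t) < 0"
    and "\<And>j. j < n \<Longrightarrow> 0 < (\<Prod>t\<in>S - {b j}. b j - t)"
    and "\<And>F. (\<Sum>s\<in>S. F s) = (\<Sum>j<n. F (a j)) + (\<Sum>j<n. F (b j) :: real)"
proof -
  define x where "x i = sorted_list_of_set S ! i" for i
  have len: "length (sorted_list_of_set S) = 2 * n" using S by simp
  have mono: "x i < x j" if "i < j" "j < 2 * n" for i j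
    using sorted_wrt_nth_less[OF strict_sorted_list_of_set[of S] that(1)] that(2) len
    by (simp add: x_def)
  have inj: "inj_on x {..<2 * n}"
    by (rule linorder_inj_onI') (use mono in \<open>force simp: less_le\<close>)
  have img: "x ` {..<2 * n} = S"
    using nth_image[of "2 * n" "sorted_list_of_set S"] len S(1) by (simp add: x_def[abs_def] lessThan_atLeast0)
  have sgn: "0 < (-1) ^ (2 * n - Suc k) * (\<Prod>t\<in>S - {x k}. x k - t)" if k: "k < 2 * n" for k
  proof -
    have "S - {x k} = x ` ({..<2 * n} - {k})"
      using inj_on_image_set_diff[OF inj, of "{..<2 * n}" "{k}"] img k by auto
    then have "(\<Prod>t\<in>S - {x k}. x k - t) = (\<Prod>l\<in>{..<2 * n} - {k}. x k - x l)"
      by (simp add: prod.reindex inj_on_diff[OF inj])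
    then show ?thesis using sign_node_diff_prod[OF mono k] by simp
  qed
  define a b where "a j = x (2 * j)" and "b j = x (2 * j + 1)" for j
  have split: "{..<2 * n} = (\<lambda>j. 2 * j) ` {..<n} \<union> (\<lambda>j. 2 * j + 1) ` {..<n}"
  proof (intro equalityI subsetI)
    fix k assume "k \<in> {..<2 * n}"
    then show "k \<in> (\<lambda>j. 2 * j) ` {..<n} \<union> (\<lambda>j. 2 * j + 1) ` {..<n}"
      by (cases "even k") (auto elim!: evenE oddE)
  qed auto
  have sum: "(\<Sum>s\<in>S. F s) = (\<Sum>j<n. F (a j)) + (\<Sum>j<n. F (b j))" for F :: "real \<Rightarrow> real"
  proof -
    have "(\<Sum>s\<in>S. F s) = (\<Sum>k<2 * n. F (x k))"
      unfolding img[symmetric] by (simp add: sum.reindex[OF inj])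
    also have "\<dots> = (\<Sum>k\<in>(\<lambda>j. 2 * j) ` {..<n}. F (x k)) + (\<Sum>k\<in>(\<lambda>j. 2 * j + 1) ` {..<n}. F (x k))"
      unfolding split by (rule sum.union_disjoint) (auto, presburger)
    also have "\<dots> = (\<Sum>j<n. F (a j)) + (\<Sum>j<n. F (b j))"
      by (simp add: sum.reindex inj_on_def a_def b_def)
    finally show ?thesis .
  qed
  show thesis
  proof (rule that[of a b])
    show "inj_on a {..<n}"
    proof (rule inj_onI)
      fix i j assume "i \<in> {..<n}" "j \<in> {..<n}" "a i = a j"
      then show "i = j" using inj_onD[OF inj, of "2 * i" "2 * j"] by (simp add: a_def)
    qed
    show "a ` {..<n} \<union> b ` {..<n} = S"
      unfolding img[symmetric] split by (auto simp: a_def b_def image_Un image_image)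
    fix j assume j: "j < n"
    have "odd (2 * n - Suc (2 * j))" "even (2 * n - Suc (2 * j + 1))" using j by presburger+
    then show "(\<Prod>t\<in>S - {a j}. a j - t) < 0" "0 < (\<Prod>t\<in>S - {b j}. b j - t)"
      using sgn[of "2 * j"] sgn[of "2 * j + 1"] j by (simp_all add: a_def b_def)
  qed (rule sum)
qed

lemma coeff_square_nonneg:
  fixes u :: "real poly"
  assumes "degree u \<le> m"
  shows "0 \<le> coeff (u * u) (2 * m)"
proof (cases "degree u = m")
  case True
  then show ?thesis using coeff_mult_degree_sum[of u u] by (simp add: mult_2)
next
  case False
  then have "degree (u * u) < 2 * m" using assms degree_mult_le[of u u] by linarith
  then show ?thesis by (simp add: coeff_eq_0)
qed

text \<open>
  Let \<open>W s = (\<Prod>t\<in>S - {s}. s - t)\<close>. For polynomials \<open>u, v\<close> of degree below \<open>n\<close> the divided difference of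
  \<open>u v\<close> vanishes, that is \<open>\<Sum>\<^sub>j (u v)(b\<^sub>j) / W(b\<^sub>j) = \<Sum>\<^sub>j (u v)(a\<^sub>j) / (- W(a\<^sub>j))\<close>. Both sides are
  the same inner product. The scaled Lagrange polynomials \<open>L k\<close> at the nodes \<open>a\<^sub>k\<close> are orthonormal for
  it, and \<open>A\<close> and \<open>B\<close> act on its \<open>n\<close>-dimensional space as multiplication by \<open>x\<close> at the nodes \<open>a\<^sub>j\<close> and
  \<open>b\<^sub>j\<close>. Thus \<open>h(B) - h(A)\<close> has the form \<open>u \<mapsto> [S] (h u\<^sup>2)\<close>. For \<open>h x = x\<close> this is the square
  of the coefficient of \<open>u\<close> at \<open>x\<^sup>n\<^sup>-\<^sup>1\<close>, whence \<open>A \<le> B\<close>. A complex vector corresponds to a pair of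
  real polynomials \<open>u, u'\<close>.
\<close>

lemma loewner_necessary:
  assumes mono: "n_monotone n G g" and S: "S \<subseteq> G" "finite S" "card S = 2 * n"
    and r: "degree r < n"
  shows "0 \<le> divdiff S (\<lambda>s. g s * (poly r s)\<^sup>2)"
proof -
  obtain a b where inj: "inj_on a {..<n}" and ab: "a ` {..<n} \<union> b ` {..<n} = S"
    and neg: "\<And>j. j < n \<Longrightarrow> (\<Prod>t\<in>S - {a j}. a j - t) < 0"
    and pos: "\<And>j. j < n \<Longrightarrow> 0 < (\<Prod>t\<in>S - {b j}. b j - t)"
    and sum: "\<And>F. (\<Sum>s\<in>S. F s) = (\<Sum>j<n. F (a j)) + (\<Sum>j<n. F (b j) :: real)"
    by (rule alternating_enumeration[OF S(2,3)]) blast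
  define p q where "p j = sqrt (- (\<Prod>t\<in>S - {a j}. a j - t))" and "q j = sqrt (\<Prod>t\<in>S - {b j}. b j - t)" for j
  have p: "p j > 0" "(p j)\<^sup>2 = - (\<Prod>t\<in>S - {a j}. a j - t)" and q: "q j > 0" "(q j)\<^sup>2 = (\<Prod>t\<in>S - {b j}. b j - t)"
    if "j < n" for j using neg[OF that] pos[OF that] by (auto simp: p_def q_def)
  have dd: "divdiff S F = (\<Sum>j<n. F (b j) / (q j)\<^sup>2) - (\<Sum>j<n. F (a j) / (p j)\<^sup>2)" for F
  proof -
    have "(\<Sum>j<n. F (b j) / (\<Prod>t\<in>S - {b j}. b j - t)) = (\<Sum>j<n. F (b j) / (q j)\<^sup>2)"
      by (intro sum.cong) (auto simp: q)
    moreover have "(\<Sum>j<n. F (a j) / (\<Prod>t\<in>S - {a j}. a j - t)) = - (\<Sum>j<n. F (a j) / (p j)\<^sup>2)"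
      unfolding sum_negf[symmetric] by (intro sum.cong) (auto simp: p)
    ultimately show ?thesis unfolding divdiff_def sum by simp
  qed
  define L where "L k = Polynomial.smult (p k / (\<Prod>l\<in>{..<n} - {k}. a k - a l)) (\<Prod>l\<in>{..<n} - {k}. [:- a l, 1:])" for k
  have L_deg: "degree (L k) \<le> n - 1" if "k < n" for k
    unfolding L_def using that
    by (intro le_trans[OF degree_smult_le]) (simp add: degree_prod_eq_sum_degree)
  have L_a: "poly (L k) (a j) = (if j = k then p k else 0)" if "k < n" "j < n" for k j
  proof -
    have "a k - a l \<noteq> 0" if "l \<in> {..<n} - {k}" for l using inj that \<open>k < n\<close> by (auto simp: inj_on_def)
    then have "(\<Prod>l\<in>{..<n} - {k}. a k - a l) \<noteq> 0" by (simp add: prod_zero_iff)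
    then show ?thesis using that by (auto simp: L_def poly_prod prod_zero_iff)
  qed
  define w where "w j k = poly (L k) (b j) / q j" for j k
  have orth: "(\<Sum>j<n. w j k * w j l) = (if k = l then 1 else 0)" if kl: "k < n" "l < n" for k l
  proof -
    have deg: "degree (L k * L l) < 2 * n - 1"
      using L_deg[OF kl(1)] L_deg[OF kl(2)] degree_mult_le[of "L k" "L l"] kl by linarith
    then have "divdiff S (poly (L k * L l)) = 0"
      using divdiff_poly[OF S(2), of "L k * L l"] S(3) by (simp add: coeff_eq_0)
    then have "(\<Sum>j<n. w j k * w j l) = (\<Sum>j<n. poly (L k) (a j) * poly (L l) (a j) / (p j)\<^sup>2)"
      unfolding dd by (simp add: w_def power2_eq_square)
    also have "\<dots> = (\<Sum>j<n. if j = k then if k = l then 1 else 0 else 0)"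
      by (intro sum.cong) (use p(1) kl in \<open>force simp: L_a power2_eq_square\<close>)+
    finally show ?thesis using kl by simp
  qed
  define U where "U = mat n n (\<lambda>(k, j). complex_of_real (w j k))"
  have U: "U \<in> carrier_mat n n" by (simp add: U_def)
  have U': "mat_adjoint U \<in> carrier_mat n n" using U by (rule mat_adjoint_carrier)
  have UU: "U * mat_adjoint U = 1\<^sub>m n"
  proof (rule eq_matI)
    fix k l assume "k < dim_row (1\<^sub>m n :: complex mat)" "l < dim_col (1\<^sub>m n :: complex mat)"
    then have kl: "k < n" "l < n" by auto
    then have "(U * mat_adjoint U) $$ (k, l) = complex_of_real (\<Sum>j<n. w j k * w j l)"
      using U by (simp add: scalar_prod_def mat_adjoint_index U_def lessThan_atLeast0)
    then show "(U * mat_adjoint U) $$ (k, l) = 1\<^sub>m n $$ (k, l)" using orth[OF kl] kl by simp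
  qed (use U in auto)
  have UU': "mat_adjoint U * U = 1\<^sub>m n" by (rule mat_mult_left_right_inverse[OF U U' UU])
  have adj1: "mat_adjoint (1\<^sub>m n) = (1\<^sub>m n :: complex mat)"
    by (rule eq_matI) (auto simp: mat_adjoint_index)
  define A where "A = 1\<^sub>m n * mat_diag n (\<lambda>i. complex_of_real (a i)) * mat_adjoint (1\<^sub>m n)"
  define B where "B = U * mat_diag n (\<lambda>i. complex_of_real (b i)) * mat_adjoint U"
  have A: "A \<in> carrier_mat n n" "hermitian_mat A" "spectrum A = (\<lambda>i. complex_of_real (a i)) ` {..<n}"
    unfolding A_def using hermitian_conjugated_diag[of "1\<^sub>m n" n a]
      spectrum_conjugated_diag[of "1\<^sub>m n" n "\<lambda>i. complex_of_real (a i)"] by (simp_all add: adj1 left_mult_one_mat[of _ n n] right_mult_one_mat[of _ n n])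
  have B: "B \<in> carrier_mat n n" "hermitian_mat B" "spectrum B = (\<lambda>i. complex_of_real (b i)) ` {..<n}"
    unfolding B_def using hermitian_conjugated_diag[OF U, of b] spectrum_conjugated_diag[OF U UU UU'] U U'
    by (auto intro!: mult_carrier_mat[of _ n n _ n])
  have sdA: "spectral_decomp A (1\<^sub>m n) a"
    using A(1) by (auto simp: spectral_decomp_def A_def unitary_mat_def adj1)
  have sdB: "spectral_decomp B U b"
    using B(1) U UU UU' by (auto simp: spectral_decomp_def B_def unitary_mat_def)
  have form: "Re ((mat_fun h B *\<^sub>v v) \<bullet>c v) - Re ((mat_fun h A *\<^sub>v v) \<bullet>c v)
      = divdiff S (\<lambda>s. h s * ((poly u s)\<^sup>2 + (poly u' s)\<^sup>2))"
    if v: "v \<in> carrier_vec n" and u: "u = (\<Sum>k<n. Polynomial.smult (Re (v $ k)) (L k))"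
      and u': "u' = (\<Sum>k<n. Polynomial.smult (Im (v $ k)) (L k))" for h v u u'
  proof -
    have "spec_wt U v j = ((poly u (b j))\<^sup>2 + (poly u' (b j))\<^sup>2) / (q j)\<^sup>2" if j: "j < n" for j
    proof -
      have *: "(mat_adjoint U *\<^sub>v v) $ j = (\<Sum>k<n. complex_of_real (w j k) * v $ k)"
        using U v j by (simp add: scalar_prod_def mat_adjoint_index U_def lessThan_atLeast0)
      have "Re ((mat_adjoint U *\<^sub>v v) $ j) = poly u (b j) / q j"
        "Im ((mat_adjoint U *\<^sub>v v) $ j) = poly u' (b j) / q j"
        by (simp_all add: * u u' poly_sum w_def sum_divide_distrib mult.commute)
      then show ?thesis by (simp add: spec_wt_def cmod_power2 power_divide add_divide_distrib)
    qed
    moreover have "spec_wt (1\<^sub>m n) v k = ((poly u (a k))\<^sup>2 + (poly u' (a k))\<^sup>2) / (p k)\<^sup>2" if k: "k < n" for k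
    proof -
      have "poly u (a k) = (\<Sum>j<n. if j = k then Re (v $ k) * p k else 0)"
        "poly u' (a k) = (\<Sum>j<n. if j = k then Im (v $ k) * p k else 0)"
        unfolding u u' poly_sum by (intro sum.cong; use k in \<open>simp add: L_a\<close>)+
      then show ?thesis using k v p(1)[OF k]
        by (simp add: spec_wt_def adj1 cmod_power2 power_mult_distrib add_divide_distrib)
    qed
    ultimately show ?thesis
      unfolding mat_fun_form[OF sdB B(1) v] mat_fun_form[OF sdA A(1) v] dd by simp
  qed
  have udeg: "degree (\<Sum>k<n. Polynomial.smult (c k) (L k)) \<le> n - 1" for c
    by (rule degree_sum_le) (use le_trans[OF degree_smult_le L_deg] in auto)
  have "loewner_le A B"
    unfolding loewner_le_form[OF A(1,2) B(1,2)]
  proof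
    fix v :: "complex vec" assume v: "v \<in> carrier_vec n"
    define u u' where "u = (\<Sum>k<n. Polynomial.smult (Re (v $ k)) (L k))"
      and "u' = (\<Sum>k<n. Polynomial.smult (Im (v $ k)) (L k))"
    have deg: "degree u \<le> n - 1" "degree u' \<le> n - 1" unfolding u_def u'_def by (rule udeg)+
    have "degree (u * u + u' * u') \<le> 2 * (n - 1)"
      using deg degree_mult_le[of u u] degree_mult_le[of u' u'] by (intro degree_add_le) linarith+
    then have "degree (pCons 0 (u * u + u' * u')) < 2 * n"
      using r degree_pCons_le[of 0 "u * u + u' * u'"] by linarith
    then have "divdiff S (poly (pCons 0 (u * u + u' * u'))) = coeff (pCons 0 (u * u + u' * u')) (Suc (2 * (n - 1)))"
      using divdiff_poly[OF S(2), of "pCons 0 (u * u + u' * u')"] S(3) r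
      by (metis Suc_diff_1 diff_Suc_1 gr_zeroI less_zeroE mult_Suc_right add_2_eq_Suc)
    also have "\<dots> \<ge> 0" using coeff_square_nonneg[OF deg(1)] coeff_square_nonneg[OF deg(2)] by simp
    also have "poly (pCons 0 (u * u + u' * u')) = (\<lambda>s. s * ((poly u s)\<^sup>2 + (poly u' s)\<^sup>2))"
      by (simp add: fun_eq_iff power2_eq_square)
    finally show "Re ((A *\<^sub>v v) \<bullet>c v) \<le> Re ((B *\<^sub>v v) \<bullet>c v)"
      using form[OF v u_def u'_def, of "\<lambda>x. x"]
      by (simp add: mat_fun_id[OF sdA A(1)] mat_fun_id[OF sdB B(1)])
  qed
  moreover have "spectrum A \<subseteq> complex_of_real ` G" "spectrum B \<subseteq> complex_of_real ` G"
    using A(3) B(3) ab S(1) by auto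
  ultimately have "loewner_le (mat_fun g A) (mat_fun g B)"
    using mono A B unfolding n_monotone_def by blast
  moreover have "hermitian_mat (mat_fun g A)" "hermitian_mat (mat_fun g B)"
    unfolding spectral_decompD(6)[OF sdA A(1)] spectral_decompD(6)[OF sdB B(1)]
    by (rule hermitian_conjugated_diag[OF one_carrier_mat], rule hermitian_conjugated_diag[OF U])
  ultimately have le: "Re ((mat_fun g A *\<^sub>v v) \<bullet>c v) \<le> Re ((mat_fun g B *\<^sub>v v) \<bullet>c v)" if "v \<in> carrier_vec n" for v
    using loewner_le_form spectral_decompD(7)[OF sdA A(1)] spectral_decompD(7)[OF sdB B(1)] that by blast
  \<comment> \<open>the coordinates of \<open>r\<close> in the orthonormal basis \<open>L\<close>\<close>
  define v where "v = vec n (\<lambda>k. complex_of_real (poly r (a k) / p k))"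
  have v: "v \<in> carrier_vec n" by (simp add: v_def)
  have "(\<Sum>k<n. Polynomial.smult (Re (v $ k)) (L k)) = r"
  proof (rule poly_eqI_degree[of "a ` {..<n}"])
    fix x assume "x \<in> a ` {..<n}"
    then obtain k where k: "k < n" "x = a k" by auto
    have "poly (\<Sum>j<n. Polynomial.smult (Re (v $ j)) (L j)) x = (\<Sum>j<n. if j = k then poly r x else 0)"
      unfolding poly_sum by (intro sum.cong) (use k p(1) in \<open>force simp: L_a v_def\<close>)+
    then show "poly (\<Sum>j<n. Polynomial.smult (Re (v $ j)) (L j)) x = poly r x" using k by simp
  qed (use r udeg[of "\<lambda>k. Re (v $ k)"] inj in \<open>auto simp: card_image\<close>)
  moreover have "(\<Sum>k<n. Polynomial.smult (Im (v $ k)) (L k)) = 0"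
    by (intro sum.neutral) (simp add: v_def)
  ultimately show ?thesis using form[OF v refl refl, of g] le[OF v] by simp
qed

section \<open>Extremal spectral differences\<close>

lemma poly_nonneg_of_punctured:
  fixes u :: "real poly"
  assumes "M < c" "\<And>x. M < x \<Longrightarrow> x \<noteq> c \<Longrightarrow> 0 \<le> poly u x"
  shows "0 \<le> poly u c"
proof (rule tendsto_lowerbound[of "poly u" _ "at c"])
  show "(poly u \<longlongrightarrow> poly u c) (at c)" using poly_isCont[of c u] by (simp add: isCont_def)
  have "eventually (\<lambda>x. M < x) (at c)"
    by (rule order_tendstoD(1)[OF tendsto_ident_at assms(1)])
  moreover have "eventually (\<lambda>x. x \<noteq> c) (at c)" by (simp add: eventually_at_filter)
  ultimately show "eventually (\<lambda>x. 0 \<le> poly u x) (at c)"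
    by eventually_elim (rule assms(2))
qed simp

lemma nonneg_poly_double_root:
  fixes u :: "real poly"
  assumes "M < c" "\<And>x. M < x \<Longrightarrow> 0 \<le> poly u x" "poly u c = 0"
  shows "\<exists>v. u = [:- c, 1:]\<^sup>2 * v \<and> (\<forall>x>M. 0 \<le> poly v x)"
proof -
  obtain u1 where u1: "u = [:- c, 1:] * u1" using assms(3) by (auto simp: poly_eq_0_iff_dvd elim: dvdE)
  have "poly (pderiv u) c = 0"
  proof (rule DERIV_local_min[OF poly_DERIV[of u c], of "c - M"])
    show "\<forall>y. \<bar>c - y\<bar> < c - M \<longrightarrow> poly u c \<le> poly u y"
      using assms by auto
  qed (use assms(1) in simp)
  then have "poly u1 c = 0" unfolding u1 pderiv_mult poly_add poly_mult by (simp add: pderiv_pCons)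
  then obtain v where v: "u1 = [:- c, 1:] * v" by (auto simp: poly_eq_0_iff_dvd elim: dvdE)
  have uv: "u = [:- c, 1:]\<^sup>2 * v" by (simp only: u1 v power2_eq_square mult.assoc)
  have "0 \<le> poly v x" if "M < x" "x \<noteq> c" for x
    using assms(2)[OF that(1)] that(2) by (simp add: uv zero_le_mult_iff)
  then have "0 \<le> poly v x" if "M < x" for x
    using poly_nonneg_of_punctured[OF assms(1)] that by blast
  then show ?thesis using uv by blast
qed

lemma nonneg_poly_double_roots:
  fixes q :: "real poly"
  assumes "finite C" "C \<subseteq> {M<..}" "\<And>x. M < x \<Longrightarrow> 0 \<le> poly q x" "\<And>c. c \<in> C \<Longrightarrow> poly q c = 0"
  shows "\<exists>v. q = (\<Prod>c\<in>C. [:- c, 1:])\<^sup>2 * v \<and> (\<forall>x>M. 0 \<le> poly v x)"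
  using assms(1,2,4)
proof (induction C rule: finite_induct)
  case empty
  then show ?case using assms(3) by auto
next
  case (insert c C)
  then obtain v where v: "q = (\<Prod>c\<in>C. [:- c, 1:])\<^sup>2 * v" "\<And>x. M < x \<Longrightarrow> 0 \<le> poly v x" by auto
  have "poly (\<Prod>c\<in>C. [:- c, 1:]) c \<noteq> 0" using insert.hyps by (auto simp: poly_prod prod_zero_iff)
  then have "poly v c = 0" using insert.prems(2)[of c] by (simp add: v(1))
  then obtain v' where v': "v = [:- c, 1:]\<^sup>2 * v'" "\<forall>x>M. 0 \<le> poly v' x"
    using nonneg_poly_double_root[of M c v] v(2) insert.prems(1) by auto
  have "q = (\<Prod>c\<in>insert c C. [:- c, 1:])\<^sup>2 * v'"
    by (simp only: v(1) v'(1) prod.insert[OF insert.hyps(1,2)] power_mult_distrib mult_ac)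
  then show ?case using v'(2) by blast
qed

text \<open>
  The node polynomial \<open>q\<close> of \<open>lam\<close> has degree at most \<open>2 n - 2\<close> because the masses sum to \<open>0\<close>, and it is
  nonnegative to the right of \<open>M\<close>. Hence its \<open>n - 1\<close> zeros in \<open>C\<close> are double, and they exhaust its degree.
\<close>

lemma resolvent_positive_extremal:
  assumes S: "finite S" "card S = 2 * n" "\<And>s. s \<in> S \<Longrightarrow> s \<le> M"
    and C: "finite C" "card C = n - 1" "C \<subseteq> {M<..}"
    and lam: "resolvent_positive M S lam" "\<exists>s\<in>S. lam s \<noteq> 0"
    and zero: "\<And>c. c \<in> C \<Longrightarrow> (\<Sum>s\<in>S. lam s / (c - s)) = 0"
  shows "\<exists>k>0. \<forall>s\<in>S. lam s = k * (\<Prod>c\<in>C. s - c)\<^sup>2 / (\<Prod>t\<in>S - {s}. s - t)"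
proof -
  define q where "q = node_poly S lam"
  have n: "n > 0" using lam(2) S(1,2) by (cases n) auto
  have notin: "c \<notin> S" if "c > M" for c using S(3)[of c] that by auto
  have qc: "poly q c = (\<Prod>t\<in>S. c - t) * (\<Sum>s\<in>S. lam s / (c - s))" if "c > M" for c
    unfolding q_def by (rule poly_node_poly[OF S(1) notin[OF that]])
  have qpos: "0 \<le> poly q c" if "c > M" for c
  proof -
    have "0 \<le> (\<Prod>t\<in>S. c - t)" using S(3) that by (intro prod_nonneg) force
    then show ?thesis using lam(1) that qc[OF that] by (simp add: resolvent_positive_def)
  qed
  have qs: "poly q s = lam s * (\<Prod>t\<in>S - {s}. s - t)" if "s \<in> S" for s
    unfolding q_def by (rule poly_node_poly_node[OF S(1) that])
  have "q \<noteq> 0"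
    using lam(2) qs node_diff_nonzero[OF S(1)] by (metis mult_eq_0_iff poly_0)
  have "coeff q (2 * n - 1) = 0" "degree q \<le> 2 * n - 1"
    using node_poly_degree[OF S(1), of lam] S(2) lam(1) by (auto simp: q_def resolvent_positive_def)
  then have deg: "degree q < 2 * n - 1"
    using \<open>q \<noteq> 0\<close> by (metis leading_coeff_0_iff nat_less_le)
  obtain v where v: "q = (\<Prod>c\<in>C. [:- c, 1:])\<^sup>2 * v" "\<And>x. M < x \<Longrightarrow> 0 \<le> poly v x"
    using nonneg_poly_double_roots[OF C(1,3) qpos] zero C(3) qc by force
  have "v \<noteq> 0" using \<open>q \<noteq> 0\<close> v(1) by auto
  have "degree ((\<Prod>c\<in>C. [:- c, 1:])\<^sup>2) = 2 * (n - 1)"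
    using prod_linear_monic[OF C(1)] C(2)
    by (subst degree_power_eq) auto
  then have "degree q = 2 * (n - 1) + degree v"
    unfolding v(1) using \<open>v \<noteq> 0\<close> \<open>q \<noteq> 0\<close> v(1) by (subst degree_mult_eq) auto
  then have "degree v = 0" using deg n by linarith
  then obtain k where k: "v = [:k:]" by (rule degree_eq_zeroE)
  have "k > 0" using v(2)[of "M + 1"] \<open>v \<noteq> 0\<close> k by auto
  moreover have "lam s = k * (\<Prod>c\<in>C. s - c)\<^sup>2 / (\<Prod>t\<in>S - {s}. s - t)" if "s \<in> S" for s
  proof -
    have "poly q s = k * (\<Prod>c\<in>C. s - c)\<^sup>2" by (simp add: v(1) k poly_power poly_prod)
    then show ?thesis using qs[OF that] node_diff_nonzero[OF S(1), of s] by (simp add: field_simps)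
  qed
  ultimately show ?thesis by blast
qed

section \<open>Dominating a perturbation by a sum of simple poles\<close>

lemma compact_coordinate_box:
  fixes B :: "'a \<Rightarrow> real set"
  assumes "\<And>i. compact (B i)"
  shows "compact {x. \<forall>i. x i \<in> B i}"
proof -
  have "compactin (product_topology (\<lambda>i. euclidean) UNIV) (PiE UNIV B)"
    unfolding compactin_PiE using assms by simp
  then have "compact (PiE UNIV B)" by (simp add: euclidean_product_topology)
  then show ?thesis by (simp add: PiE_def Pi_def)
qed

text \<open>
  On the compact set where \<open>h \<le> 0\<close> the function \<open>p\<close> has a positive minimum, and \<open>h\<close> is bounded below.
\<close>

lemma penalty_compact:
  fixes p h :: "'a :: topological_space \<Rightarrow> real"
  assumes X: "compact X" and cont: "continuous_on X p" "continuous_on X h"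
    and p: "\<And>x. x \<in> X \<Longrightarrow> 0 \<le> p x" and h: "\<And>x. x \<in> X \<Longrightarrow> p x = 0 \<Longrightarrow> 0 < h x"
  shows "\<exists>K0. \<forall>K\<ge>K0. \<forall>x\<in>X. 0 \<le> K * p x + h x"
proof -
  define Y where "Y = {x \<in> X. h x \<le> 0}"
  have "closedin (top_of_set X) (X \<inter> h -` {..0})"
    using continuous_closedin_preimage[OF cont(2), of "{..0}"] by simp
  moreover have "X \<inter> h -` {..0} = Y" by (auto simp: Y_def)
  ultimately have Y: "compact Y" using closedin_compact[OF X] by metis
  have YX: "Y \<subseteq> X" by (auto simp: Y_def)
  show ?thesis
  proof (cases "Y = {}")
    case True
    then have "0 < h x" if "x \<in> X" for x using that by (auto simp: Y_def not_le)
    then have "0 \<le> K * p x + h x" if "K \<ge> 0" "x \<in> X" for K x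
      using that by (meson add_nonneg_nonneg mult_nonneg_nonneg less_imp_le p)
    then show ?thesis by blast
  next
    case False
    obtain y where y: "y \<in> Y" "\<And>x. x \<in> Y \<Longrightarrow> p y \<le> p x"
      using continuous_attains_inf[OF Y False continuous_on_subset[OF cont(1) YX]] by auto
    obtain z where z: "z \<in> Y" "\<And>x. x \<in> Y \<Longrightarrow> h z \<le> h x"
      using continuous_attains_inf[OF Y False continuous_on_subset[OF cont(2) YX]] by auto
    have py: "p y > 0" using p[of y] h[of y] y(1) by (force simp: Y_def)
    have hz: "h z \<le> 0" using z(1) by (simp add: Y_def)
    have "0 \<le> K * p x + h x" if K: "K \<ge> - h z / p y" and x: "x \<in> X" for K x
    proof (cases "x \<in> Y")
      case True
      have "K \<ge> 0" using order_trans[OF divide_nonneg_pos[of "- h z" "p y"] K] py hz by simp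
      have "- h z \<le> K * p y" using K py by (simp add: field_simps)
      also have "\<dots> \<le> K * p x" using y(2)[OF True] \<open>K \<ge> 0\<close> by (rule mult_left_mono)
      finally show ?thesis using z(2)[OF True] by linarith
    next
      case False
      then have "0 < h x" using x by (auto simp: Y_def not_le)
      moreover have "K \<ge> 0" using order_trans[OF divide_nonneg_pos[of "- h z" "p y"] K] py hz by simp
      ultimately show ?thesis using p[OF x] by (simp add: add_nonneg_nonneg)
    qed
    then show ?thesis by blast
  qed
qed

text \<open>
  The admissible masses form a closed cone in a finite-dimensional space. Both terms are linear in
  \<open>lam\<close>, so it suffices to compare them on the compact slice where the absolute masses sum to \<open>1\<close>.
\<close>

lemma exists_pole_weight:
  assumes S: "finite S" and C: "C \<subseteq> {M<..}"
    and pos: "\<And>lam. \<lbrakk>resolvent_positive M S lam; \<exists>s\<in>S. lam s \<noteq> 0;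
      \<And>c. c \<in> C \<Longrightarrow> (\<Sum>s\<in>S. lam s / (c - s)) = 0\<rbrakk> \<Longrightarrow> 0 < (\<Sum>s\<in>S. lam s * h s)"
    and fC: "finite C"
  shows "\<exists>K0. \<forall>K\<ge>K0. \<forall>lam. resolvent_positive M S lam \<longrightarrow>
    0 \<le> (\<Sum>s\<in>S. lam s * (K * (\<Sum>c\<in>C. 1 / (c - s)) + h s))"
proof -
  define box where "box = {lam :: real \<Rightarrow> real. \<forall>s. lam s \<in> (if s \<in> S then {-1..1} else {0})}"
  define X where "X = box \<inter> ({lam. (\<Sum>s\<in>S. lam s) = 0}
    \<inter> (\<Inter>c\<in>{M<..}. {lam. 0 \<le> (\<Sum>s\<in>S. lam s / (c - s))}) \<inter> {lam. (\<Sum>s\<in>S. \<bar>lam s\<bar>) = 1})"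
  have cont: "continuous_on A (\<lambda>lam :: real \<Rightarrow> real. lam s)" for A s
    by (rule continuous_on_subset[OF continuous_on_product_coordinates subset_UNIV])
  note [continuous_intros] = cont
  have "compact X"
    unfolding X_def
  proof (rule compact_Int_closed)
    show "compact box" unfolding box_def by (rule compact_coordinate_box) auto
    show "closed ({lam. (\<Sum>s\<in>S. lam s) = 0} \<inter> (\<Inter>c\<in>{M<..}. {lam. 0 \<le> (\<Sum>s\<in>S. lam s / (c - s))})
      \<inter> {lam :: real \<Rightarrow> real. (\<Sum>s\<in>S. \<bar>lam s\<bar>) = 1})"
      unfolding divide_inverse
      by (intro closed_Int closed_INT ballI closed_Collect_eq closed_Collect_le continuous_intros)
  qed
  define p where "p lam = (\<Sum>c\<in>C. \<Sum>s\<in>S. lam s * (1 / (c - s)))" for lam :: "real \<Rightarrow> real"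
  define H where "H lam = (\<Sum>s\<in>S. lam s * h s)" for lam :: "real \<Rightarrow> real"
  have split: "(\<Sum>s\<in>S. lam s * (K * (\<Sum>c\<in>C. 1 / (c - s)) + h s)) = K * p lam + H lam" for K lam
    unfolding p_def H_def sum.swap[of _ S C]
    by (simp add: algebra_simps sum.distrib sum_distrib_left)
  have ppos: "0 \<le> p lam" if "resolvent_positive M S lam" for lam
    unfolding p_def by (rule sum_nonneg) (use that C in \<open>auto simp: resolvent_positive_def\<close>)
  have rp: "resolvent_positive M S lam" if "lam \<in> X" for lam
    using that by (auto simp: X_def resolvent_positive_def)
  have "\<exists>K0. \<forall>K\<ge>K0. \<forall>lam\<in>X. 0 \<le> K * p lam + H lam"
  proof (rule penalty_compact)
    show "compact X" by fact
    show "continuous_on X p" "continuous_on X H"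
      unfolding p_def H_def by (intro continuous_intros)+
    show "0 \<le> p lam" if "lam \<in> X" for lam using rp[OF that] by (rule ppos)
    show "0 < H lam" if "lam \<in> X" "p lam = 0" for lam
      unfolding H_def
    proof (rule pos)
      show "resolvent_positive M S lam" using that(1) by (rule rp)
      then have "0 \<le> (\<Sum>s\<in>S. lam s * (1 / (c - s)))" if "c \<in> C" for c
        using C that by (auto simp: resolvent_positive_def)
      then show "(\<Sum>s\<in>S. lam s / (c - s)) = 0" if "c \<in> C" for c
        using \<open>p lam = 0\<close> that sum_nonneg_eq_0_iff[OF fC, of "\<lambda>c. \<Sum>s\<in>S. lam s * (1 / (c - s))"]
        by (simp add: p_def)
      show "\<exists>s\<in>S. lam s \<noteq> 0"
      proof (rule ccontr)
        assume "\<not> (\<exists>s\<in>S. lam s \<noteq> 0)"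
        then have "(\<Sum>s\<in>S. \<bar>lam s\<bar>) = 0" by simp
        then show False using \<open>lam \<in> X\<close> by (simp add: X_def)
      qed
    qed
  qed
  then obtain K0 where K0: "\<And>K lam. K \<ge> K0 \<Longrightarrow> lam \<in> X \<Longrightarrow> 0 \<le> K * p lam + H lam" by blast
  have "0 \<le> K * p lam + H lam" if K: "K \<ge> K0" and lam: "resolvent_positive M S lam" for K lam
  proof -
    define N where "N = (\<Sum>s\<in>S. \<bar>lam s\<bar>)"
    have N0: "N \<ge> 0" by (simp add: N_def sum_nonneg)
    have le: "\<bar>lam s\<bar> \<le> N" if "s \<in> S" for s
      unfolding N_def by (rule member_le_sum) (use that S in auto)
    show ?thesis
    proof (cases "N = 0")
      case True
      then have "\<forall>s\<in>S. lam s = 0" using le by force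
      then show ?thesis by (simp add: p_def H_def)
    next
      case False
      then have N: "N > 0" using N0 by simp
      define lam' where "lam' s = (if s \<in> S then lam s / N else 0)" for s
      have sc: "(\<Sum>s\<in>S. lam' s * g s) = (\<Sum>s\<in>S. lam s * g s) / N" for g
        by (simp add: lam'_def sum_divide_distrib)
      have "lam' s \<in> (if s \<in> S then {-1..1} else {0})" for s
        using le[of s] N by (auto simp: lam'_def abs_le_iff field_simps)
      moreover have "(\<Sum>s\<in>S. \<bar>lam' s\<bar>) = 1"
        using N by (simp add: lam'_def N_def flip: sum_divide_distrib)
      moreover have "(\<Sum>s\<in>S. lam' s) = 0" using sc[of "\<lambda>_. 1"] lam by (simp add: resolvent_positive_def)
      moreover have "0 \<le> (\<Sum>s\<in>S. lam' s / (c - s))" if "M < c" for c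
        using sc[of "\<lambda>s. 1 / (c - s)"] lam that N by (simp add: resolvent_positive_def)
      ultimately have "lam' \<in> X" by (auto simp: X_def box_def)
      then have "0 \<le> K * p lam' + H lam'" using K0 K by blast
      also have "\<dots> = (K * p lam + H lam) / N"
        by (simp only: p_def H_def sc) (simp add: sum_divide_distrib[symmetric] add_divide_distrib)
      finally show ?thesis using N by (simp add: zero_le_divide_iff)
    qed
  qed
  then show ?thesis unfolding split by blast
qed

section \<open>A function with nonnegative divided differences and a kink\<close>

definition branch_poly :: "nat \<Rightarrow> real poly" where
  "branch_poly n = (\<Prod>t\<in>real ` {3..2 * n}. [:- t, 1:])"

text \<open>
  On the nodes \<open>1, \<dots>, 2 n\<close> this function agrees with \<open>0\<close>, on the nodes \<open>3, \<dots>, 2 n + 2\<close> with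
  \<open>branch_poly n\<close>.
\<close>

definition kinked :: "nat \<Rightarrow> real \<Rightarrow> real" where
  "kinked n s = (if s \<le> real (2 * n) then 0 else poly (branch_poly n) s)"

lemma poly_branch_poly: "poly (branch_poly n) s = (\<Prod>t\<in>real ` {3..2 * n}. s - t)"
  by (simp add: branch_poly_def poly_prod)

lemma mobius_mono:
  fixes u v a b :: real
  assumes "b < u" "u \<le> v" "b \<le> a"
  shows "(u - a) / (u - b) \<le> (v - a) / (v - b)"
proof -
  have "(u - a) * (v - b) \<le> (v - a) * (u - b)"
    using mult_right_mono[of u v "a - b"] assms by (simp add: algebra_simps)
  then show ?thesis using assms by (simp add: divide_simps mult.commute)
qed

text \<open>
  If \<open>S\<close> misses one of the two largest nodes, then \<open>kinked n\<close> is nonzero at most at the largest point of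
  \<open>S\<close>, where the node product is positive. Otherwise \<open>S\<close> misses two nodes \<open>a < b\<close> among \<open>1, \<dots>, 2 n\<close>,
  and cancelling common factors turns the divided difference into \<open>\<psi>(2 n + 2) - \<psi>(2 n + 1)\<close>
  with \<open>\<psi>(x) = ((x - a) / (x - 1)) ((x - b) / (x - 2))\<close>; this function increases because \<open>a \<ge> 1\<close> and \<open>b \<ge> 2\<close>.
\<close>

lemma divdiff_kinked_nonneg:
  assumes n: "n \<ge> 2" and S: "S \<subseteq> real ` {1..2 * n + 2}" "card S = 2 * n"
  shows "0 \<le> divdiff S (kinked n)"
proof -
  define u v where "u = real (2 * n + 1)" and "v = real (2 * n + 2)"
  have fS: "finite S" using S(1) by (rule finite_subset) simp
  have zero: "kinked n s = 0" if s: "s \<in> S" "s \<noteq> u" "s \<noteq> v" for s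
  proof -
    obtain k where k: "s = real k" "k \<in> {1..2 * n + 2}" using subsetD[OF S(1) s(1)] by blast
    moreover have "k \<noteq> 2 * n + 1" "k \<noteq> 2 * n + 2"
      using s(2,3) k(1) unfolding u_def v_def by blast+
    ultimately have "k \<le> 2 * n" by simp
    then show ?thesis using k by (simp add: kinked_def)
  qed
  have pos: "0 \<le> kinked n s" for s
    unfolding kinked_def poly_branch_poly by (auto intro!: prod_nonneg)
  show ?thesis
  proof (cases "u \<in> S \<and> v \<in> S")
    case False
    have "0 \<le> kinked n s / (\<Prod>t\<in>S - {s}. s - t)" if s: "s \<in> S" for s
    proof (cases "s = u \<or> s = v")
      case True
      have "t \<le> s" if t: "t \<in> S" for t
        using True
      proof
        assume "s = v" then show ?thesis using t S(1) by (auto simp: v_def)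
      next
        assume "s = u"
        then have "t \<noteq> v" using False s t by auto
        moreover obtain k where k: "t = real k" "k \<in> {1..2 * n + 2}" using subsetD[OF S(1) t] by blast
        ultimately have "k \<noteq> 2 * n + 2" unfolding v_def by blast
        then show ?thesis using k \<open>s = u\<close> by (simp add: u_def)
      qed
      then have "0 \<le> (\<Prod>t\<in>S - {s}. s - t)" by (intro prod_nonneg) auto
      then show ?thesis using pos by simp
    qed (use zero s in auto)
    then show ?thesis unfolding divdiff_def by (intro sum_nonneg)
  next
    case True
    define S0 where "S0 = S - {u, v}"
    define E where "E = real ` {1..2 * n}"
    have uv: "v = u + 1" "u \<noteq> v" by (simp_all add: u_def v_def)
    have Fuv: "real ` {1..2 * n + 2} = insert u (insert v E)"
    proof -
      have "{1..2 * n + 2} = insert (2 * n + 1) (insert (2 * n + 2) {1..2 * n})" by auto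
      then show ?thesis by (simp add: E_def u_def v_def)
    qed
    have S0: "S0 \<subseteq> E" "finite S0" using S(1) Fuv fS by (auto simp: S0_def)
    have "card (E - S0) = 2"
    proof -
      have "card S0 = 2 * n - 2" using S(2) True uv(2) fS by (simp add: S0_def card_Diff_subset)
      moreover have "card E = 2 * n" by (simp add: E_def card_image)
      ultimately show ?thesis using S0 n by (simp add: card_Diff_subset)
    qed
    then obtain i j where ij: "E - S0 = {i, j}" "i \<noteq> j" by (auto simp: card_2_iff)
    then obtain a b where ab: "E - S0 = {a, b}" "a < b" by (metis insert_commute linorder_neqE_linordered_idom)
    have abE: "a \<in> E" "b \<in> E" using ab by auto
    obtain a' b' where ab': "a = real a'" "b = real b'" "1 \<le> a'" "b' \<le> 2 * n"
      using abE by (auto simp: E_def)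
    then have ab1: "1 \<le> a" "2 \<le> b" "b \<le> real (2 * n)" "a \<le> real (2 * n)" using ab(2) by auto
    have prodE: "(\<Prod>t\<in>E. x - t) = (\<Prod>t\<in>S0. x - t) * ((x - a) * (x - b))" for x :: real
    proof -
      have "E = S0 \<union> {a, b}" "S0 \<inter> {a, b} = {}" using ab S0 by auto
      then show ?thesis using S0(2) ab(2) by (simp add: prod.union_disjoint)
    qed
    have prodE': "(\<Prod>t\<in>E. x - t) = (x - 1) * (x - 2) * poly (branch_poly n) x" for x :: real
    proof -
      have "{1..2 * n} = insert 1 (insert 2 {3..2 * n})" using n by auto
      then have "E = insert 1 (insert 2 (real ` {3..2 * n}))" by (simp add: E_def)
      moreover have "1 \<notin> insert 2 (real ` {3..2 * n})" "2 \<notin> real ` {3..2 * n}" by auto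
      ultimately show ?thesis by (simp add: poly_branch_poly mult.assoc)
    qed
    \<comment> \<open>the product over all nodes in \<open>E\<close>, written in two ways, gives \<open>psi\<close>\<close>
    define psi where "psi x = (x - a) / (x - 1) * ((x - b) / (x - 2))" for x :: real
    have key: "poly (branch_poly n) x / (\<Prod>t\<in>S0. x - t) = psi x" if x: "x > real (2 * n)" for x
    proof -
      have "0 < (\<Prod>t\<in>S0. x - t)"
        using S0(1) x by (intro prod_pos) (auto simp: E_def)
      moreover have "x - 1 > 0" "x - 2 > 0" using x n by auto
      ultimately show ?thesis
        using prodE[of x] prodE'[of x]
        by (simp add: psi_def times_divide_times_eq frac_eq_eq mult_ac)
    qed
    have Su: "S - {u} = insert v S0" "S - {v} = insert u S0" using True uv by (auto simp: S0_def)
    have big: "u > real (2 * n)" "v > real (2 * n)" and diff: "u - v = - 1" "v - u = 1"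
      by (simp_all add: u_def v_def)
    have notS0: "u \<notin> S0" "v \<notin> S0" by (auto simp: S0_def)
    have "S = insert u (insert v S0)" using True by (auto simp: S0_def)
    then have "divdiff S (kinked n) = kinked n u / (\<Prod>t\<in>S - {u}. u - t) + kinked n v / (\<Prod>t\<in>S - {v}. v - t)
        + (\<Sum>s\<in>S0. kinked n s / (\<Prod>t\<in>S - {s}. s - t))"
      unfolding divdiff_def using uv(2) notS0 S0(2) by simp
    also have "(\<Sum>s\<in>S0. kinked n s / (\<Prod>t\<in>S - {s}. s - t)) = 0"
      by (intro sum.neutral) (auto simp: S0_def zero)
    also have "kinked n u / (\<Prod>t\<in>S - {u}. u - t) = - psi u"
      unfolding Su prod.insert[OF S0(2) notS0(2)] diff using key[OF big(1)] big(1) by (simp add: kinked_def)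
    also have "kinked n v / (\<Prod>t\<in>S - {v}. v - t) = psi v"
      unfolding Su prod.insert[OF S0(2) notS0(1)] diff using key[OF big(2)] big(2) by (simp add: kinked_def)
    finally have eq: "divdiff S (kinked n) = psi v - psi u" by simp
    have "psi u \<le> psi v"
      unfolding psi_def
    proof (rule mult_mono)
      show "(u - a) / (u - 1) \<le> (v - a) / (v - 1)" "(u - b) / (u - 2) \<le> (v - b) / (v - 2)"
        using ab1 n by (intro mobius_mono; simp add: u_def v_def)+
      show "0 \<le> (v - a) / (v - 1)" "0 \<le> (u - b) / (u - 2)"
        using ab1 n by (auto simp: u_def v_def intro!: divide_nonneg_nonneg)
    qed
    then show ?thesis using eq by simp
  qed
qed

section \<open>The function without extension\<close>

text \<open>
  Any \<open>n - 1\<close> points to the right of the nodes \<open>1, \<dots>, 2 n + 2\<close> would serve.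
\<close>

definition pole_set :: "nat \<Rightarrow> real set" where
  "pole_set n = real ` {2 * n + 3..3 * n + 1}"

lemma pole_set_props: "finite (pole_set n)" "n \<ge> 1 \<Longrightarrow> card (pole_set n) = n - 1" "pole_set n \<subseteq> {real (2 * n + 2)<..}"
  by (auto simp: pole_set_def card_image)

definition pole_poly :: "nat \<Rightarrow> real poly" where
  "pole_poly n = (\<Prod>c\<in>pole_set n. [:- c, 1:])"

lemma pole_poly_nonzero: "s \<le> real (2 * n + 2) \<Longrightarrow> poly (pole_poly n) s \<noteq> 0"
  using pole_set_props(1,3)[of n] by (auto simp: pole_poly_def poly_prod prod_zero_iff)

text \<open>
  Multiplication by \<open>pole_poly n\<close> clears the poles, so the sum of simple poles is invisible to the
  divided differences of order \<open>2 n - 1\<close> that are taken after multiplication by \<open>(pole_poly n)\<^sup>2\<close>.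
\<close>

lemma pole_sum_times_poly:
  assumes "n \<ge> 1"
  obtains q where "degree q < 2 * n - 1"
    "\<And>s. s \<le> real (2 * n + 2) \<Longrightarrow> (\<Sum>c\<in>pole_set n. 1 / (c - s)) * (poly (pole_poly n) s)\<^sup>2 = poly q s"
proof -
  let ?C = "pole_set n"
  define q where "q = - (\<Sum>c\<in>?C. (\<Prod>d\<in>?C - {c}. [:- d, 1:]) * pole_poly n)"
  have card: "card ?C = n - 1" using pole_set_props(2) assms by simp
  have "degree ((\<Prod>d\<in>?C - {c}. [:- d, 1:]) * pole_poly n) \<le> 2 * n - 2" if "c \<in> ?C" for c
    using degree_mult_le[of "\<Prod>d\<in>?C - {c}. [:- d, 1:]" "pole_poly n"] prod_linear_monic(1)[of ?C]
      prod_linear_monic(1)[of "?C - {c}"] pole_set_props(1)[of n] card that by (simp add: pole_poly_def)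
  then have "degree q \<le> 2 * n - 2" unfolding q_def degree_minus using pole_set_props(1)
    by (intro degree_sum_le)
  then have "degree q < 2 * n - 1" using assms by linarith
  moreover have "(\<Sum>c\<in>?C. 1 / (c - s)) * (poly (pole_poly n) s)\<^sup>2 = poly q s" if s: "s \<le> real (2 * n + 2)" for s
  proof -
    have "1 / (c - s) * (poly (pole_poly n) s)\<^sup>2 = - ((\<Prod>d\<in>?C - {c}. s - d) * poly (pole_poly n) s)"
      if c: "c \<in> ?C" for c
    proof -
      have "c > s" using c s pole_set_props(3)[of n] by auto
      have "poly (pole_poly n) s = (s - c) * (\<Prod>d\<in>?C - {c}. s - d)"
        unfolding prod.remove[OF pole_set_props(1) c, symmetric] by (simp add: pole_poly_def poly_prod)
      then have "1 / (c - s) * (poly (pole_poly n) s)\<^sup>2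
          = (1 / (c - s) * (s - c)) * ((\<Prod>d\<in>?C - {c}. s - d) * poly (pole_poly n) s)"
        by (metis mult.assoc power2_eq_square)
      moreover have "1 / (c - s) * (s - c) = - 1" using \<open>c > s\<close> by (simp add: divide_simps)
      ultimately show ?thesis by (simp only: mult_minus_left mult_1_left)
    qed
    then show ?thesis by (simp add: q_def poly_sum poly_prod sum_distrib_right sum_negf)
  qed
  ultimately show thesis by (rule that)
qed

text \<open>
  Multiplication by \<open>(pole_poly n)\<^sup>2\<close> turns the first summand into a polynomial of degree at most
  \<open>2 n - 2\<close> and the second one into \<open>kinked n s + e s\<^sup>2\<^sup>n\<^sup>-\<^sup>1\<close>. The parameter \<open>K\<close> is chosen after \<open>e\<close>.
\<close>

definition gap_fun :: "nat \<Rightarrow> real \<Rightarrow> real \<Rightarrow> real \<Rightarrow> real" where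
  "gap_fun n K e s = K * (\<Sum>c\<in>pole_set n. 1 / (c - s)) + (kinked n s + e * s ^ (2 * n - 1)) / (poly (pole_poly n) s)\<^sup>2"

text \<open>
  On the extremal masses the divided difference of \<open>kinked n s + e s\<^sup>2\<^sup>n\<^sup>-\<^sup>1\<close> appears, which is at least
  \<open>e\<close>. As there are finitely many sets \<open>S\<close> of nodes, one \<open>K\<close> serves all of them.
\<close>

lemma exists_n_monotone_gap_fun:
  assumes n: "n \<ge> 2" and e: "e > 0"
  shows "\<exists>K. n_monotone n (real ` {1..2 * n + 2}) (gap_fun n K e)"
proof -
  let ?F = "real ` {1..2 * n + 2}" and ?M = "real (2 * n + 2)" and ?C = "pole_set n"
  let ?h = "\<lambda>s. (kinked n s + e * s ^ (2 * n - 1)) / (poly (pole_poly n) s)\<^sup>2"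
  have "eventually (\<lambda>K. \<forall>lam. resolvent_positive ?M S lam \<longrightarrow>
      0 \<le> (\<Sum>s\<in>S. lam s * gap_fun n K e s)) at_top"
    if S: "S \<in> {S. S \<subseteq> ?F \<and> card S = 2 * n}" for S
  proof -
    have fS: "finite S" using S by (auto intro: finite_subset)
    have SM: "s \<le> ?M" if "s \<in> S" for s using S that by auto
    have "0 < (\<Sum>s\<in>S. lam s * ?h s)"
      if lam: "resolvent_positive ?M S lam" "\<exists>s\<in>S. lam s \<noteq> 0" "\<And>c. c \<in> ?C \<Longrightarrow> (\<Sum>s\<in>S. lam s / (c - s)) = 0" for lam
    proof -
      have "\<exists>k>0. \<forall>s\<in>S. lam s = k * (\<Prod>c\<in>?C. s - c)\<^sup>2 / (\<Prod>t\<in>S - {s}. s - t)"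
        by (rule resolvent_positive_extremal[OF fS _ SM pole_set_props(1) _ pole_set_props(3) lam])
          (use S n pole_set_props(2)[of n] in auto)
      then obtain k where k: "k > 0" "\<And>s. s \<in> S \<Longrightarrow> lam s = k * (\<Prod>c\<in>?C. s - c)\<^sup>2 / (\<Prod>t\<in>S - {s}. s - t)"
        by blast
      have "lam s * ?h s = k * ((kinked n s + e * s ^ (2 * n - 1)) / (\<Prod>t\<in>S - {s}. s - t))" if "s \<in> S" for s
        using pole_poly_nonzero[OF SM[OF that]] k(2)[OF that]
        by (simp add: pole_poly_def poly_prod)
      then have "(\<Sum>s\<in>S. lam s * ?h s) = k * divdiff S (\<lambda>s. kinked n s + e * s ^ (2 * n - 1))"
        by (simp add: divdiff_def sum_distrib_left)
      also have "divdiff S (\<lambda>s. kinked n s + e * s ^ (2 * n - 1)) = divdiff S (kinked n) + e"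
        using divdiff_power[OF fS, of "2 * n - 1"] S n by (simp add: divdiff_add divdiff_cmult)
      also have "k * \<dots> > 0"
      proof (rule mult_pos_pos[OF k(1)])
        have "0 \<le> divdiff S (kinked n)" by (rule divdiff_kinked_nonneg[OF n]) (use S in auto)
        then show "0 < divdiff S (kinked n) + e" using e by simp
      qed
      finally show ?thesis .
    qed
    then show ?thesis
      using exists_pole_weight[OF fS pole_set_props(3) _ pole_set_props(1), of n ?h]
      unfolding eventually_at_top_linorder gap_fun_def by blast
  qed
  then have "eventually (\<lambda>K. \<forall>S\<in>{S. S \<subseteq> ?F \<and> card S = 2 * n}. \<forall>lam. resolvent_positive ?M S lam \<longrightarrow>
      0 \<le> (\<Sum>s\<in>S. lam s * gap_fun n K e s)) at_top"
    by (intro eventually_ball_finite) auto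
  then obtain K where "\<forall>S\<in>{S. S \<subseteq> ?F \<and> card S = 2 * n}. \<forall>lam. resolvent_positive ?M S lam \<longrightarrow>
      0 \<le> (\<Sum>s\<in>S. lam s * gap_fun n K e s)"
    using eventually_happens'[OF trivial_limit_at_top_linorder] by blast
  then have "n_monotone n ?F (gap_fun n K e)"
    by (intro n_monotone_criterion[where M = ?M]) (auto simp: card_image)
  then show ?thesis by blast
qed

lemma half_integer_notin: "real (2 * n) - 1 / 2 \<notin> real ` A"
proof
  assume "real (2 * n) - 1 / 2 \<in> real ` A"
  then obtain k where "real (2 * n) - 1 / 2 = real k" by auto
  then have "real (4 * n) = real (2 * k + 1)" by simp
  then have "4 * n = 2 * k + 1" by (simp only: of_nat_eq_iff)
  then show False by presburger
qed

text \<open>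
  After multiplication by \<open>(pole_poly n)\<^sup>2\<close> and subtraction of the terms with known divided differences,
  an extension amounts to a value \<open>y\<close> at \<open>x0\<close> that extends \<open>kinked n\<close> with divided differences at
  least \<open>- e\<close>. The nodes \<open>L\<close> to the left of \<open>x0\<close>, where \<open>kinked n\<close> vanishes, give \<open>y \<ge> - e D1\<close>. The nodes
  \<open>R\<close>, where it agrees with \<open>branch_poly n\<close>, give \<open>y \<le> branch_poly n x0 + e |D2|\<close>, because an odd
  number of them, namely three, lies to the right of \<open>x0\<close>. Since \<open>branch_poly n\<close> is negative at \<open>x0\<close>, a small \<open>e\<close>
  makes these bounds contradict each other.
\<close>

lemma gap_fun_not_extendable:
  assumes n: "n \<ge> 2"
  defines "x0 \<equiv> real (2 * n) - 1 / 2"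
  shows "\<exists>e>0. \<forall>K g. (\<forall>s\<in>real ` {1..2 * n + 2}. g s = gap_fun n K e s) \<longrightarrow>
    \<not> n_monotone n (real ` {1..2 * n + 2} \<union> {x0}) g"
proof -
  define L R where "L = real ` {1..2 * n - 1}" and "R = real ` {4..2 * n + 2}"
  define D1 D2 where "D1 = (\<Prod>t\<in>L. x0 - t)" and "D2 = (\<Prod>t\<in>R. x0 - t)"
  have notin: "x0 \<notin> real ` A" for A :: "nat set" unfolding x0_def by (rule half_integer_notin)
  have D1: "D1 > 0" unfolding D1_def L_def x0_def by (intro prod_pos) auto
  have D2: "D2 < 0"
  proof -
    have "{4..2 * n + 2} = {4..2 * n - 1} \<union> {2 * n, 2 * n + 1, 2 * n + 2}" using n by auto
    then have "R = real ` {4..2 * n - 1} \<union> {real (2 * n), real (2 * n + 1), real (2 * n + 2)}"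
      by (simp add: R_def image_Un)
    then have "D2 = (\<Prod>t\<in>real ` {4..2 * n - 1}. x0 - t)
        * (\<Prod>t\<in>{real (2 * n), real (2 * n + 1), real (2 * n + 2)}. x0 - t)"
      unfolding D2_def using n by (simp only:) (rule prod.union_disjoint, auto)
    also have "(\<Prod>t\<in>{real (2 * n), real (2 * n + 1), real (2 * n + 2)}. x0 - t) = - 15 / 8"
      by (simp add: x0_def)
    moreover have "0 < (\<Prod>t\<in>real ` {4..2 * n - 1}. x0 - t)" unfolding x0_def by (intro prod_pos) auto
    ultimately show ?thesis by simp
  qed
  have N: "poly (branch_poly n) x0 < 0"
  proof -
    have "{3..2 * n} = insert (2 * n) {3..2 * n - 1}" using n by auto
    then have "real ` {3..2 * n} = insert (real (2 * n)) (real ` {3..2 * n - 1})" by (metis image_insert)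
    moreover have "real (2 * n) \<notin> real ` {3..2 * n - 1}"
    proof
      assume "real (2 * n) \<in> real ` {3..2 * n - 1}"
      then obtain k where "real (2 * n) = real k" "k \<in> {3..2 * n - 1}" by blast
      then show False using n by (simp only: of_nat_eq_iff) auto
    qed
    ultimately have "poly (branch_poly n) x0 = (x0 - real (2 * n)) * (\<Prod>t\<in>real ` {3..2 * n - 1}. x0 - t)"
      by (simp only: poly_branch_poly prod.insert finite_imageI finite_atLeastAtMost not_False_eq_True)
    moreover have "0 < (\<Prod>t\<in>real ` {3..2 * n - 1}. x0 - t)" unfolding x0_def by (intro prod_pos) auto
    ultimately show ?thesis by (simp add: x0_def)
  qed
  \<comment> \<open>half the value at which the two bounds \<open>- e D1\<close> and \<open>branch_poly n x0 - e D2\<close> meet\<close>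
  define e where "e = - poly (branch_poly n) x0 / (2 * (D1 - D2))"
  have e: "e > 0" using N D1 D2 by (simp add: e_def divide_neg_pos)
  have e2: "2 * (e * (D1 - D2)) = - poly (branch_poly n) x0" 
  proof -
    have "2 * (- p / (2 * w) * w) = - p" if "w \<noteq> 0" for p w :: real using that by simp
    from this[of "D1 - D2"] show ?thesis using D1 D2 unfolding e_def by simp
  qed
  show ?thesis
  proof (intro exI[of _ e] conjI allI impI notI)
    show "e > 0" by (rule e)
    fix K g assume ext: "\<forall>s\<in>real ` {1..2 * n + 2}. g s = gap_fun n K e s"
      and mono: "n_monotone n (real ` {1..2 * n + 2} \<union> {x0}) g"
    obtain q where q: "degree q < 2 * n - 1"
      "\<And>s. s \<le> real (2 * n + 2) \<Longrightarrow> (\<Sum>c\<in>pole_set n. 1 / (c - s)) * (poly (pole_poly n) s)\<^sup>2 = poly q s"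
      using pole_sum_times_poly[of n] n by auto
    define y where "y = g x0 * (poly (pole_poly n) x0)\<^sup>2 - K * poly q x0 - e * x0 ^ (2 * n - 1)"
    have main: "0 \<le> e + divdiff (insert x0 T) (\<lambda>s. if s = x0 then y else kinked n s)"
      if T: "T \<subseteq> real ` {1..2 * n + 2}" "card T = 2 * n - 1" for T
    proof -
      have fT: "finite T" using T(1) by (rule finite_subset) simp
      have "x0 \<notin> T" using T(1) notin by auto
      then have card: "card (insert x0 T) = 2 * n" using T(2) fT n by simp
      have "degree (pole_poly n) < n"
        using prod_linear_monic(1)[OF pole_set_props(1)[of n]] pole_set_props(2)[of n] n by (simp add: pole_poly_def)
      then have "0 \<le> divdiff (insert x0 T) (\<lambda>s. g s * (poly (pole_poly n) s)\<^sup>2)"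
        using T(1) fT card by (intro loewner_necessary[OF mono]) auto
      also have "\<dots> = divdiff (insert x0 T) (\<lambda>s. K * poly q s + (e * s ^ (2 * n - 1) + (if s = x0 then y else kinked n s)))"
      proof (rule divdiff_cong)
        fix s assume s: "s \<in> insert x0 T"
        show "g s * (poly (pole_poly n) s)\<^sup>2 = K * poly q s + (e * s ^ (2 * n - 1) + (if s = x0 then y else kinked n s))"
        proof (cases "s = x0")
          case False
          then have sT: "s \<in> T" using s by simp
          then have sM: "s \<le> real (2 * n + 2)" using T(1) by auto
          have "g s = gap_fun n K e s" using ext sT T(1) by blast
          then have "g s * (poly (pole_poly n) s)\<^sup>2 = K * poly q s + (kinked n s + e * s ^ (2 * n - 1))"
            using pole_poly_nonzero[OF sM]
            by (simp only: gap_fun_def distrib_right[of _ _ "(poly (pole_poly n) s)\<^sup>2"] mult.assoc q(2)[OF sM]) simp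
          then show ?thesis using False by simp
        qed (simp add: y_def)
      qed
      also have "\<dots> = K * divdiff (insert x0 T) (poly q) + (e * divdiff (insert x0 T) (\<lambda>s. s ^ (2 * n - 1))
          + divdiff (insert x0 T) (\<lambda>s. if s = x0 then y else kinked n s))"
        by (simp only: divdiff_add divdiff_cmult)
      also have "divdiff (insert x0 T) (poly q) = 0"
        using divdiff_poly[of "insert x0 T" q] fT card q(1) by (simp add: coeff_eq_0)
      also have "divdiff (insert x0 T) (\<lambda>s. s ^ (2 * n - 1)) = 1"
        using divdiff_power[of "insert x0 T" "2 * n - 1"] fT card n by simp
      finally show ?thesis by simp
    qed
    have "x0 \<notin> L" "x0 \<notin> R" "finite L" "finite R" using notin by (auto simp: L_def R_def)
    have LF: "L \<subseteq> real ` {1..2 * n + 2}" "card L = 2 * n - 1"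
      and RF: "R \<subseteq> real ` {1..2 * n + 2}" "card R = 2 * n - 1"
      unfolding L_def R_def by (auto simp: card_image intro!: image_mono)
    have "0 \<le> e + y / D1"
    proof -
      have "divdiff (insert x0 L) (\<lambda>s. if s = x0 then y else kinked n s) = divdiff (insert x0 L) (\<lambda>s. if s = x0 then y else 0)"
        by (rule divdiff_cong) (auto simp: L_def kinked_def)
      also have "\<dots> = y / D1"
        using divdiff_single[of "insert x0 L" x0 y] \<open>x0 \<notin> L\<close> \<open>finite L\<close> by (simp add: D1_def)
      finally show ?thesis using main[OF LF] by simp
    qed
    then have lower: "- (e * D1) \<le> y" using D1 by (simp add: field_simps)
    have "0 \<le> e + (y - poly (branch_poly n) x0) / D2"
    proof -
      have zero: "poly (branch_poly n) s = 0" if "s \<in> R" "s \<le> real (2 * n)" for s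
        using that by (auto simp: R_def poly_branch_poly prod_zero_iff)
      have "divdiff (insert x0 R) (\<lambda>s. if s = x0 then y else kinked n s)
        = divdiff (insert x0 R) (\<lambda>s. poly (branch_poly n) s + (if s = x0 then y - poly (branch_poly n) x0 else 0))"
        by (rule divdiff_cong) (auto simp: kinked_def zero)
      also have "\<dots> = divdiff (insert x0 R) (poly (branch_poly n)) + (y - poly (branch_poly n) x0) / D2"
        using divdiff_single[of "insert x0 R" x0] \<open>x0 \<notin> R\<close> \<open>finite R\<close> by (simp add: divdiff_add D2_def)
      also have "divdiff (insert x0 R) (poly (branch_poly n)) = 0"
      proof -
        have "degree (branch_poly n) = 2 * n - 2"
          unfolding branch_poly_def using n by (subst prod_linear_monic(1)) (auto simp: card_image)
        moreover have "card (insert x0 R) = 2 * n"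
          using \<open>x0 \<notin> R\<close> \<open>finite R\<close> n by (simp add: R_def card_image)
        ultimately show ?thesis
          using divdiff_poly[of "insert x0 R" "branch_poly n"] \<open>finite R\<close> n by (simp add: coeff_eq_0)
      qed
      finally show ?thesis using main[OF RF] by simp
    qed
    then have upper: "y \<le> poly (branch_poly n) x0 - e * D2" using D2 by (simp add: field_simps)
    show False using lower upper e2 N by (simp add: algebra_simps)
  qed
qed

theorem theorem7p5:
  fixes n :: nat
  assumes "n > 1"
  shows "\<exists>(F :: real set) (f :: real \<Rightarrow> real) (x0 :: real).
    n_monotone n F f \<and> x0 \<in> convex hull F - F \<and>
    \<not> (\<exists>g :: real \<Rightarrow> real. n_monotone n (F \<union> {x0}) g \<and> (\<forall>x\<in>F. g x = f x))"
proof -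
  let ?F = "real ` {1..2 * n + 2}" and ?x0 = "real (2 * n) - 1 / 2"
  have n: "n \<ge> 2" using assms by simp
  obtain e where e: "e > 0" "\<And>K g. (\<forall>s\<in>?F. g s = gap_fun n K e s) \<Longrightarrow> \<not> n_monotone n (?F \<union> {?x0}) g"
    using gap_fun_not_extendable[OF n] by blast
  obtain K where K: "n_monotone n ?F (gap_fun n K e)" using exists_n_monotone_gap_fun[OF n e(1)] by blast
  have "?x0 \<in> convex hull ?F"
  proof -
    have "real (2 * n - 1) \<in> convex hull ?F" by (rule hull_inc, rule imageI) (use n in auto)
    moreover have "real (2 * n) \<in> convex hull ?F" by (rule hull_inc, rule imageI) (use n in auto)
    ultimately have "(1 / 2) *\<^sub>R real (2 * n - 1) + (1 / 2) *\<^sub>R real (2 * n) \<in> convex hull ?F"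
      by (rule convexD[OF convex_convex_hull]) auto
    moreover have "(1 / 2) *\<^sub>R real (2 * n - 1) + (1 / 2) *\<^sub>R real (2 * n) = ?x0"
      using n by (simp add: of_nat_diff field_simps)
    ultimately show ?thesis by (simp only:)
  qed
  moreover have "?x0 \<notin> ?F" by (rule half_integer_notin)
  ultimately show ?thesis using K e(2) by (intro exI[of _ ?F] exI[of _ "gap_fun n K e"] exI[of _ ?x0]) blast
qed

end
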